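(* Let $\pi = 1 \oplus \rho$ be a permutation of length $n \ge 4$ of the form $1\,n\cdots 2$, i.e. $\pi(1)=1$, $\pi(2)=n$ and $\pi(n)=2$, and suppose $\rho$ has no increasing bond. Then the class $\operatorname{Av}(\pi)$ is not deflatable.
   Context: A permutation $\alpha$ is contained in $\beta$ if $\beta$ has a subsequence in the same relative order as $\alpha$; a class is a set of permutations closed under taking contained permutations; $\operatorname{Av}(\pi)$ is the class of permutations not containing $\pi$. $1\oplus\rho$ denotes a new minimum entry placed before a copy of $\rho$. A bond of a permutation is a pair of entries in adjacent positions whose values differ by $1$; it is increasing if they form the pattern $12$. An interval of a permutation is a set of entries whose positions and values each form a set of consecutive integers, the whole permutation not counting as an interval; a permutation is simple if all its intervals are single entries (so $1$, $12$, $21$ are simple). A class $\mathcal{C}$ is deflatable if there is a proper subclass $\mathcal{D}\subsetneq\mathcal{C}$ with $\mathcal{C}\subseteq\langle\mathcal{D}\rangle$, where the substitution closure $\langle\mathcal{D}\rangle$ is the largest class whose simple permutations are exactly those of $\mathcal{D}$; equivalently, $\mathcal{C}$ is not deflatable if and only if every permutation in $\mathcal{C}$ is contained in some simple permutation belonging to $\mathcal{C}$. *)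

theory Defs
  imports "HOL-Combinatorics.Multiset_Permutations" "HOL-Library.Sublist"
begin

text \<open>
  Permutations are in one-line notation, as nonempty lists of natural numbers; the \<open>i\<close>-th entry
  of \<open>\<sigma>\<close>, counted from 1, is \<open>\<sigma> ! (i - 1)\<close>. The empty permutation is excluded.
\<close>

definition is_perm :: "nat list \<Rightarrow> bool" where
  "is_perm \<sigma> \<longleftrightarrow> \<sigma> \<noteq> [] \<and> \<sigma> \<in> permutations_of_set {1..length \<sigma>}"

definition order_isomorphic :: "nat list \<Rightarrow> nat list \<Rightarrow> bool" where
  "order_isomorphic xs ys \<longleftrightarrow> length xs = length ys \<and>
     (\<forall>i<length xs. \<forall>j<length xs. xs ! i < xs ! j \<longleftrightarrow> ys ! i < ys ! j)"

definition contained :: "nat list \<Rightarrow> nat list \<Rightarrow> bool" where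
  "contained \<alpha> \<beta> \<longleftrightarrow> (\<exists>s. subseq s \<beta> \<and> order_isomorphic \<alpha> s)"

definition perm_class :: "nat list set \<Rightarrow> bool" where
  "perm_class C \<longleftrightarrow> (\<forall>\<beta>\<in>C. is_perm \<beta>) \<and>
     (\<forall>\<beta>\<in>C. \<forall>\<alpha>. is_perm \<alpha> \<and> contained \<alpha> \<beta> \<longrightarrow> \<alpha> \<in> C)"

definition Av :: "nat list \<Rightarrow> nat list set" where
  "Av \<pi> = {\<sigma>. is_perm \<sigma> \<and> \<not> contained \<pi> \<sigma>}"

definition one_oplus :: "nat list \<Rightarrow> nat list" where
  "one_oplus \<rho> = 1 # map Suc \<rho>"

definition bond_at :: "nat list \<Rightarrow> nat \<Rightarrow> bool" where
  "bond_at \<sigma> i \<longleftrightarrow> Suc i < length \<sigma> \<and> \<bar>int (\<sigma> ! Suc i) - int (\<sigma> ! i)\<bar> = 1"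

definition has_increasing_bond :: "nat list \<Rightarrow> bool" where
  "has_increasing_bond \<sigma> \<longleftrightarrow> (\<exists>i. bond_at \<sigma> i \<and> \<sigma> ! i < \<sigma> ! Suc i)"

text \<open>
  A set of entries is represented by the set \<open>I\<close> of its positions (counted from 0). Intervals are
  nonempty, and the whole permutation is not an interval.
\<close>

definition interval :: "nat list \<Rightarrow> nat set \<Rightarrow> bool" where
  "interval \<sigma> I \<longleftrightarrow> I \<noteq> {} \<and> I \<subset> {..<length \<sigma>} \<and>
     (\<exists>a b. I = {a..b}) \<and> (\<exists>c d. (!) \<sigma> ` I = {c..d})"

definition simple_perm :: "nat list \<Rightarrow> bool" where
  "simple_perm \<sigma> \<longleftrightarrow> is_perm \<sigma> \<and> (\<forall>I. interval \<sigma> I \<longrightarrow> card I = 1)"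

definition simples :: "nat list set \<Rightarrow> nat list set" where
  "simples C = {\<sigma> \<in> C. simple_perm \<sigma>}"

text \<open>
  The largest class with the same simple permutations as \<open>D\<close> is the union of all such classes;
  the lemma below confirms that this union is one of them.
\<close>

definition subst_closure :: "nat list set \<Rightarrow> nat list set" where
  "subst_closure D = \<Union>{E. perm_class E \<and> simples E = simples D}"

lemma subst_closure_greatest:
  assumes "perm_class D"
  shows "perm_class (subst_closure D)"
    and "simples (subst_closure D) = simples D"
    and "\<And>E. perm_class E \<Longrightarrow> simples E = simples D \<Longrightarrow> E \<subseteq> subst_closure D"
proof -
  show "perm_class (subst_closure D)"
    unfolding subst_closure_def perm_class_def by blast
  show "simples (subst_closure D) = simples D"
    using assms unfolding subst_closure_def simples_def by blast
  show "E \<subseteq> subst_closure D" if "perm_class E" "simples E = simples D" for E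
    using that unfolding subst_closure_def by blast
qed

definition deflatable :: "nat list set \<Rightarrow> bool" where
  "deflatable C \<longleftrightarrow> (\<exists>D. perm_class D \<and> D \<subset> C \<and> C \<subseteq> subst_closure D)"

end

theory Submission imports Defs Complex_Main begin

text \<open>
  Permutations are handled as finite point sets in the plane, which keeps the inverse symmetry
  (a reflection) of the hypotheses on \<open>\<pi>\<close> visible and leaves room for inserting points.
  Surrounding a permutation \<open>\<alpha>\<close> avoiding \<open>\<pi>\<close> by four points, so that \<open>\<alpha>\<close> becomes the \<open>2\<close> of \<open>42513\<close>,
  makes it sum- and skew-indecomposable without creating \<open>\<pi>\<close>. Afterwards intervals are
  destroyed one at a time. Take a maximal proper interval \<open>I\<close>. If some point lies below and to the
  left of \<open>I\<close>, let \<open>m\<close> be the lowest point to the left of \<open>I\<close> and insert a new left-to-right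
  minimum just below \<open>m\<close> that separates two points of \<open>I\<close> horizontally. Otherwise
  indecomposability provides points above and to the right of \<open>I\<close>; let \<open>w\<close> be the leftmost of
  them and insert a point just below \<open>w\<close> and just to the left of the rightmost point of \<open>I\<close> (or do
  the reflected insertion). A copy of \<open>\<pi>\<close> using the new point can be redirected to \<open>w\<close>
  (to a point of \<open>I\<close> if the new point is its entry \<open>1\<close>), except when it uses both the new point
  and \<open>w\<close>, and then these would form an increasing bond of \<open>\<rho>\<close>. The separation is
  arranged so that the new point lies in no interval, hence the number of intervals drops.
\<close>

subsection \<open>Point sets, embeddings and blocks\<close>

text \<open>Point sets in general position are drawings of permutations; over the reals there is
  always room between two coordinates.\<close>

definition generic :: "(real \<times> real) set \<Rightarrow> bool" where
  "generic P \<longleftrightarrow> finite P \<and> inj_on fst P \<and> inj_on snd P"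

text \<open>One-way implications suffice: on a \<open>generic\<close> set they become equivalences
  and force injectivity, so \<open>emb\<close> is pattern containment.\<close>

definition order_preserving :: "(real \<times> real \<Rightarrow> real \<times> real) \<Rightarrow> (real \<times> real) set \<Rightarrow> bool" where
  "order_preserving f Q \<longleftrightarrow> (\<forall>p\<in>Q. \<forall>q\<in>Q.
     (fst p < fst q \<longrightarrow> fst (f p) < fst (f q)) \<and> (snd p < snd q \<longrightarrow> snd (f p) < snd (f q)))"

definition emb :: "(real \<times> real) set \<Rightarrow> (real \<times> real) set \<Rightarrow> bool" where
  "emb Q P \<longleftrightarrow> (\<exists>f. f ` Q \<subseteq> P \<and> order_preserving f Q)"

definition block :: "(real \<times> real) set \<Rightarrow> (real \<times> real) set \<Rightarrow> bool" where
  "block P I \<longleftrightarrow> I \<subseteq> P \<and> (\<forall>p\<in>P. \<forall>a\<in>I. \<forall>b\<in>I.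
     (fst a < fst p \<and> fst p < fst b \<longrightarrow> p \<in> I) \<and> (snd a < snd p \<and> snd p < snd b \<longrightarrow> p \<in> I))"

text \<open>With the trivial cases excluded, \<open>blocks P = {}\<close> expresses simplicity.
  \<open>block\<close> itself admits them, which spares case distinctions when blocks are restricted
  or united.\<close>

definition blocks :: "(real \<times> real) set \<Rightarrow> (real \<times> real) set set" where
  "blocks P = {I. block P I \<and> I \<noteq> P \<and> (\<exists>p\<in>I. \<exists>q\<in>I. p \<noteq> q)}"

definition decomposable :: "(real \<times> real) set \<Rightarrow> bool" where
  "decomposable P \<longleftrightarrow> (\<exists>A B. A \<noteq> {} \<and> B \<noteq> {} \<and> A \<union> B = P \<and> (\<forall>a\<in>A. \<forall>b\<in>B. fst a < fst b) \<and>
     ((\<forall>a\<in>A. \<forall>b\<in>B. snd a < snd b) \<or> (\<forall>a\<in>A. \<forall>b\<in>B. snd b < snd a)))"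

text \<open>
  The properties of \<open>\<pi>\<close> that matter: \<open>a\<close>, \<open>b\<close>, \<open>d\<close> are its entries \<open>1\<close>, \<open>n\<close>, \<open>2\<close>. Reflection
  in the diagonal swaps the roles of \<open>b\<close> and \<open>d\<close>.
\<close>

definition bondless_wedge ::
  "(real \<times> real) set \<Rightarrow> real \<times> real \<Rightarrow> real \<times> real \<Rightarrow> real \<times> real \<Rightarrow> bool" where
  "bondless_wedge Q a b d \<longleftrightarrow> generic Q \<and> a \<in> Q \<and> b \<in> Q \<and> d \<in> Q \<and> a \<noteq> b \<and> a \<noteq> d \<and>
     (\<exists>g\<in>Q. g \<notin> {a, b, d}) \<and>
     (\<forall>p\<in>Q - {a}. fst a < fst p \<and> snd a < snd p) \<and>
     (\<forall>p\<in>Q - {a, b}. fst b < fst p \<and> snd p < snd b) \<and>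
     (\<forall>p\<in>Q - {a, d}. fst p < fst d \<and> snd d < snd p) \<and>
     (\<forall>p\<in>Q - {a}. \<forall>q\<in>Q. fst p < fst q \<and> snd p < snd q \<longrightarrow>
        (\<exists>r\<in>Q. fst p < fst r \<and> fst r < fst q \<or> snd p < snd r \<and> snd r < snd q))"

lemma generic_eq:
  assumes "generic P" "p \<in> P" "q \<in> P" "fst p = fst q \<or> snd p = snd q"
  shows "p = q"
  using assms unfolding generic_def by (meson inj_onD)

lemma order_preserving_inj:
  assumes "generic Q" "order_preserving f Q"
  shows "inj_on f Q"
proof (rule inj_onI)
  fix p q assume h: "p \<in> Q" "q \<in> Q" "f p = f q"
  have "\<not> fst p < fst q" "\<not> fst q < fst p"
    using assms(2) h unfolding order_preserving_def by (metis less_irrefl)+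
  thus "p = q" using generic_eq[OF assms(1) h(1,2)] by fastforce
qed

lemma order_preserving_iff:
  assumes "generic Q" "order_preserving f Q" "p \<in> Q" "q \<in> Q"
  shows "fst (f p) < fst (f q) \<longleftrightarrow> fst p < fst q" "snd (f p) < snd (f q) \<longleftrightarrow> snd p < snd q"
proof -
  have *: "fst p < fst q \<Longrightarrow> fst (f p) < fst (f q)" "fst q < fst p \<Longrightarrow> fst (f q) < fst (f p)"
    "snd p < snd q \<Longrightarrow> snd (f p) < snd (f q)" "snd q < snd p \<Longrightarrow> snd (f q) < snd (f p)"
    using assms unfolding order_preserving_def by auto
  note eq = generic_eq[OF assms(1,3,4)]
  show "fst (f p) < fst (f q) \<longleftrightarrow> fst p < fst q"
    using *(1,2) eq by (cases "fst p" "fst q" rule: linorder_cases) auto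
  show "snd (f p) < snd (f q) \<longleftrightarrow> snd p < snd q"
    using *(3,4) eq by (cases "snd p" "snd q" rule: linorder_cases) auto
qed

lemma emb_trans: "emb A B \<Longrightarrow> emb B C \<Longrightarrow> emb A C"
  unfolding emb_def
proof clarify
  fix f g assume h: "f ` A \<subseteq> B" "order_preserving f A" "g ` B \<subseteq> C" "order_preserving g B"
  have "order_preserving (g \<circ> f) A" using h unfolding order_preserving_def
    by (simp add: image_subset_iff)
  moreover have "(g \<circ> f) ` A \<subseteq> C" using h by (auto simp: image_subset_iff)
  ultimately show "\<exists>f. f ` A \<subseteq> C \<and> order_preserving f A" by blast
qed

text \<open>The tool for removing a new point \<open>z\<close> from a copy of the pattern: its
  preimage \<open>k\<close> is redirected to a point \<open>w\<close> already present. As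
  \<open>f\<close> is injective, no other entry sits on \<open>z\<close>, so the changed map stays
  in \<open>P\<close>.\<close>

lemma emb_replace:
  assumes Q: "generic Q" and f: "f ` Q \<subseteq> insert z P" "order_preserving f Q"
    and k: "k \<in> Q" "f k = z" and w: "w \<in> P"
    and "\<And>p. p \<in> Q \<Longrightarrow> fst p < fst k \<Longrightarrow> fst (f p) < fst w"
    and "\<And>p. p \<in> Q \<Longrightarrow> fst k < fst p \<Longrightarrow> fst w < fst (f p)"
    and "\<And>p. p \<in> Q \<Longrightarrow> snd p < snd k \<Longrightarrow> snd (f p) < snd w"
    and "\<And>p. p \<in> Q \<Longrightarrow> snd k < snd p \<Longrightarrow> snd w < snd (f p)"
  shows "emb Q P"
  unfolding emb_def
proof (intro exI conjI)
  show "f(k := w) ` Q \<subseteq> P"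
  proof
    fix x assume "x \<in> f(k := w) ` Q"
    then obtain p where p: "p \<in> Q" "x = (if p = k then w else f p)" by auto
    show "x \<in> P"
    proof (cases "p = k")
      case False
      hence "f p \<noteq> z" using order_preserving_inj[OF Q f(2)] k p(1) by (meson inj_onD)
      thus ?thesis using f(1) p False by auto
    qed (use p w in auto)
  qed
  show "order_preserving (f(k := w)) Q"
    using assms(7-) f(2) k unfolding order_preserving_def by auto
qed

lemma blockD:
  assumes "block P I" "a \<in> I" "b \<in> I" "p \<in> P"
  shows "fst a < fst p \<Longrightarrow> fst p < fst b \<Longrightarrow> p \<in> I" "snd a < snd p \<Longrightarrow> snd p < snd b \<Longrightarrow> p \<in> I"
  using assms unfolding block_def by blast+

text \<open>By genericity an outside point shares no coordinate with the block, and it never lies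
  between two of its points. Every outside point thus belongs to one of four quadrants around the
  block.\<close>

lemma block_side:
  assumes "generic P" "block P I" "p \<in> P" "p \<notin> I"
  shows "(\<forall>i\<in>I. fst p < fst i) \<or> (\<forall>i\<in>I. fst i < fst p)"
    and "(\<forall>i\<in>I. snd p < snd i) \<or> (\<forall>i\<in>I. snd i < snd p)"
proof -
  have ne: "fst p < fst i \<or> fst i < fst p" "snd p < snd i \<or> snd i < snd p" if "i \<in> I" for i
    using that assms generic_eq[of P p i] linorder_neq_iff unfolding block_def by blast+
  have btw: "\<not> (fst i < fst p \<and> fst p < fst j)" "\<not> (snd i < snd p \<and> snd p < snd j)"
    if "i \<in> I" "j \<in> I" for i j
    using that assms unfolding block_def by blast+
  show "(\<forall>i\<in>I. fst p < fst i) \<or> (\<forall>i\<in>I. fst i < fst p)" using ne(1) btw(1) by blast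
  show "(\<forall>i\<in>I. snd p < snd i) \<or> (\<forall>i\<in>I. snd i < snd p)" using ne(2) btw(2) by blast
qed

text \<open>A point outside both blocks lies on one side of each; the common point \<open>x\<close>
  forces these sides to agree, horizontally and vertically.\<close>

lemma block_union:
  assumes P: "generic P" and K: "block P K" and I: "block P I" and x: "x \<in> K" "x \<in> I"
  shows "block P (K \<union> I)"
proof -
  have "p \<in> K \<union> I" if p: "p \<in> P" and ab: "a \<in> K \<union> I" "b \<in> K \<union> I"
    and btw: "fst a < fst p \<and> fst p < fst b \<or> snd a < snd p \<and> snd p < snd b" for p a b
  proof (rule ccontr)
    assume n: "p \<notin> K \<union> I"
    hence n: "p \<notin> K" "p \<notin> I" by auto
    have "(\<forall>i\<in>K \<union> I. fst p < fst i) \<or> (\<forall>i\<in>K \<union> I. fst i < fst p)"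
      using block_side(1)[OF P K p n(1)] block_side(1)[OF P I p n(2)] x less_asym by blast
    moreover have "(\<forall>i\<in>K \<union> I. snd p < snd i) \<or> (\<forall>i\<in>K \<union> I. snd i < snd p)"
      using block_side(2)[OF P K p n(1)] block_side(2)[OF P I p n(2)] x less_asym by blast
    ultimately show False using ab btw less_asym by blast
  qed
  thus ?thesis using K I unfolding block_def by blast
qed

lemma decomposableI:
  assumes "A \<noteq> {}" "B \<noteq> {}" "A \<union> B = P" "\<forall>a\<in>A. \<forall>b\<in>B. fst a < fst b"
    "(\<forall>a\<in>A. \<forall>b\<in>B. snd a < snd b) \<or> (\<forall>a\<in>A. \<forall>b\<in>B. snd b < snd a)"
  shows "decomposable P"
  using assms unfolding decomposable_def by blast

text \<open>
  The point \<open>y\<close> separates \<open>z\<close> from \<open>I\<close> vertically, so an interval containing \<open>z\<close> cannot stay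
  inside \<open>I\<close>; leaving \<open>I\<close> contradicts its maximality or the indecomposability.
\<close>

lemma cut_step:
  assumes P: "generic P" and z: "generic (insert z P)" "z \<notin> P"
    and I: "I \<in> blocks P" and max: "\<And>J. J \<in> blocks P \<Longrightarrow> I \<subseteq> J \<Longrightarrow> J = I"
    and indec: "\<not> decomposable P"
    and lr: "l \<in> I" "r \<in> I" "fst l < fst z" "fst z < fst r"
    and y: "y \<in> P" "y \<notin> I"
      "(\<forall>i\<in>I. snd i < snd y \<and> snd y < snd z) \<or> (\<forall>i\<in>I. snd z < snd y \<and> snd y < snd i)"
  shows "blocks (insert z P) \<subseteq> blocks P - {I}" and "\<not> decomposable (insert z P)"
proof -
  have Ib: "block P I" and IP: "I \<noteq> P" using I unfolding blocks_def by blast+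
  hence IP: "I \<noteq> P" "I \<subseteq> P" unfolding block_def by blast+
  have notz: "z \<notin> J" if J: "J \<in> blocks (insert z P)" for J
  proof
    assume zJ: "z \<in> J"
    \<comment> \<open>The trace of \<open>J\<close> on \<open>P\<close> is again a block, possibly a
      single point, but not all of \<open>P\<close>, since \<open>J\<close> contains
      \<open>z\<close> and is proper.\<close>
    define K where "K = J - {z}"
    have Jb: "block (insert z P) J" and JP: "J \<noteq> insert z P" using J unfolding blocks_def by auto
    have K: "block P K" using Jb z(2) unfolding K_def block_def by blast
    have KP: "K \<noteq> P" using JP zJ unfolding K_def by auto
    have KJ: "K \<subseteq> J" "K \<subseteq> P" using K unfolding K_def block_def by blast+
    obtain k where k: "k \<in> K" using J unfolding blocks_def K_def by blast
    \<comment> \<open>A point \<open>k\<close> outside \<open>I\<close> is left of \<open>l\<close>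
      or right of \<open>r\<close>, while \<open>z\<close> lies between these two; convexity of
      \<open>J\<close> from \<open>k\<close> to \<open>z\<close> then brings \<open>l\<close> or
      \<open>r\<close> into \<open>J\<close>.\<close>
    have "\<exists>x. x \<in> K \<and> x \<in> I"
    proof (cases "k \<in> I")
      case False
      have lz: "l \<noteq> z" "r \<noteq> z" using lr by auto
      have lrP: "l \<in> insert z P" "r \<in> insert z P" using lr IP by auto
      consider "fst k < fst l" | "fst r < fst k"
        using block_side(1)[OF P Ib, of k] False k KJ lr by blast
      thus ?thesis
      proof cases
        case 1
        hence "l \<in> J" using blockD(1)[OF Jb _ zJ lrP(1), of k] k KJ(1) lr(3) by auto
        thus ?thesis using lr lz unfolding K_def by blast
      next
        case 2
        hence "r \<in> J" using blockD(1)[OF Jb zJ _ lrP(2), of k] k KJ(1) lr(4) by auto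
        thus ?thesis using lr lz unfolding K_def by blast
      qed
    next
      case True
      show ?thesis by (rule exI[of _ k]) (rule conjI[OF k True])
    qed
    then obtain x where x: "x \<in> K" "x \<in> I" by blast
    have un: "block P (K \<union> I)" by (rule block_union[OF P K Ib x])
    show False
    proof (cases "K \<union> I = P")
      case False
      hence "K \<union> I \<in> blocks P" using un I unfolding blocks_def by blast
      \<comment> \<open>So \<open>J\<close> leaves \<open>I\<close> only in \<open>z\<close>; but
        \<open>y\<close> separates \<open>z\<close> from \<open>x\<close> vertically, and
        \<open>J\<close> would have to contain \<open>y\<close>, which is outside
        \<open>I\<close>.\<close>
      hence KI: "K \<subseteq> I" using max[of "K \<union> I"] by auto
      have "x \<in> J" "y \<in> insert z P" using x KJ y by auto
      hence "y \<in> J" using y(3) blockD(2)[OF Jb, of x z y] blockD(2)[OF Jb, of z x y] zJ x(2) by auto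
      thus False using y(1,2) z(2) KI unfolding K_def by auto
    next
      case True
      then obtain j where j: "j \<in> P" "j \<notin> I" "j \<in> K" using IP by blast
      obtain i where i: "i \<in> I" "i \<notin> K" using KP KJ True by blast
      \<comment> \<open>Here \<open>K\<close> and \<open>I\<close> cover \<open>P\<close>, so
        \<open>D\<close> lies in \<open>I\<close>. The point \<open>j\<close> of \<open>K\<close>
        outside \<open>I\<close> has all of \<open>I\<close>, hence all of \<open>D\<close>, on one
        side in each direction; this fixes the side of \<open>K\<close> on which \<open>D\<close>
        lies and decomposes \<open>P\<close> into \<open>D\<close> and \<open>K\<close>.\<close>
      define D where "D = P - K"
      have DI: "D \<subseteq> I" using True unfolding D_def by blast
      have iD: "i \<in> D" "D \<noteq> {}" "K \<noteq> {}" using i IP x unfolding D_def by auto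
      have f: "(\<forall>p\<in>D. \<forall>q\<in>K. fst p < fst q) \<or> (\<forall>p\<in>D. \<forall>q\<in>K. fst q < fst p)"
      proof -
        have side: "(\<forall>q\<in>K. fst p < fst q) \<or> (\<forall>q\<in>K. fst q < fst p)" if "p \<in> D" for p
          using block_side(1)[OF P K, of p] that unfolding D_def by blast
        from block_side(1)[OF P Ib j(1,2)] show ?thesis
        proof
          assume "\<forall>i\<in>I. fst j < fst i"
          hence "\<not> fst p < fst j" if "p \<in> D" for p using that DI by (auto simp: less_le_not_le)
          hence "\<forall>p\<in>D. \<forall>q\<in>K. fst q < fst p" using side j(3) by blast
          thus ?thesis ..
        next
          assume "\<forall>i\<in>I. fst i < fst j"
          hence "\<not> fst j < fst p" if "p \<in> D" for p using that DI by (auto simp: less_le_not_le)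
          hence "\<forall>p\<in>D. \<forall>q\<in>K. fst p < fst q" using side j(3) by blast
          thus ?thesis ..
        qed
      qed
      have s: "(\<forall>p\<in>D. \<forall>q\<in>K. snd p < snd q) \<or> (\<forall>p\<in>D. \<forall>q\<in>K. snd q < snd p)"
      proof -
        have side: "(\<forall>q\<in>K. snd p < snd q) \<or> (\<forall>q\<in>K. snd q < snd p)" if "p \<in> D" for p
          using block_side(2)[OF P K, of p] that unfolding D_def by blast
        from block_side(2)[OF P Ib j(1,2)] show ?thesis
        proof
          assume "\<forall>i\<in>I. snd j < snd i"
          hence "\<not> snd p < snd j" if "p \<in> D" for p using that DI by (auto simp: less_le_not_le)
          hence "\<forall>p\<in>D. \<forall>q\<in>K. snd q < snd p" using side j(3) by blast
          thus ?thesis ..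
        next
          assume "\<forall>i\<in>I. snd i < snd j"
          hence "\<not> snd j < snd p" if "p \<in> D" for p using that DI by (auto simp: less_le_not_le)
          hence "\<forall>p\<in>D. \<forall>q\<in>K. snd p < snd q" using side j(3) by blast
          thus ?thesis ..
        qed
      qed
      have DK: "D \<union> K = P" "K \<union> D = P" using KJ unfolding D_def by auto
      have "decomposable P"
        using f
      proof
        assume "\<forall>p\<in>D. \<forall>q\<in>K. fst p < fst q"
        thus ?thesis using decomposableI[OF iD(2,3) DK(1)] s by blast
      next
        assume "\<forall>p\<in>D. \<forall>q\<in>K. fst q < fst p"
        hence "\<forall>q\<in>K. \<forall>p\<in>D. fst q < fst p" by blast
        moreover have "(\<forall>q\<in>K. \<forall>p\<in>D. snd q < snd p) \<or> (\<forall>q\<in>K. \<forall>p\<in>D. snd p < snd q)"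
          using s by blast
        ultimately show ?thesis using decomposableI[OF iD(3,2) DK(2)] by blast
      qed
      thus False using indec by blast
    qed
  qed
  \<comment> \<open>A block without \<open>z\<close> is a block of \<open>P\<close>. It cannot
    contain both \<open>l\<close> and \<open>r\<close>, as \<open>z\<close> lies between them, which
    excludes \<open>I\<close> and \<open>P\<close>.\<close>
  show "blocks (insert z P) \<subseteq> blocks P - {I}"
  proof
    fix J assume J: "J \<in> blocks (insert z P)"
    have lrJ: "\<not> (l \<in> J \<and> r \<in> J)"
      using blockD(1)[of "insert z P" J l r z] J notz[OF J] lr unfolding blocks_def by auto
    hence "J \<noteq> I" using lr by auto
    moreover have "J \<in> blocks P"
    proof -
      have "J \<noteq> P" using lrJ lr IP by auto
      moreover have "block P J" using notz[OF J] J unfolding blocks_def block_def by blast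
      ultimately show ?thesis using J unfolding blocks_def by simp
    qed
    ultimately show "J \<in> blocks P - {I}" by blast
  qed
  \<comment> \<open>Deleting \<open>z\<close> from a decomposition would leave one of
    \<open>P\<close>: neither part is just \<open>{z}\<close>, because \<open>l\<close> is to the
    left and \<open>r\<close> to the right of \<open>z\<close>.\<close>
  show "\<not> decomposable (insert z P)"
  proof
    assume "decomposable (insert z P)"
    then obtain A B where AB: "A \<noteq> {}" "B \<noteq> {}" "A \<union> B = insert z P"
      "\<forall>a\<in>A. \<forall>b\<in>B. fst a < fst b"
      "(\<forall>a\<in>A. \<forall>b\<in>B. snd a < snd b) \<or> (\<forall>a\<in>A. \<forall>b\<in>B. snd b < snd a)"
      unfolding decomposable_def by blast
    have lP: "l \<in> P" "r \<in> P" "l \<noteq> z" "r \<noteq> z" using lr IP by auto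
    have "A - {z} \<noteq> {}"
    proof
      assume "A - {z} = {}"
      hence "A = {z}" using AB(1) by blast
      hence "z \<in> A" "l \<in> B" using AB(3) lP by auto
      thus False using AB(4) lr(3) by fastforce
    qed
    moreover have "B - {z} \<noteq> {}"
    proof
      assume "B - {z} = {}"
      hence "B = {z}" using AB(2) by blast
      hence "z \<in> B" "r \<in> A" using AB(3) lP by auto
      thus False using AB(4) lr(4) by fastforce
    qed
    moreover have "(A - {z}) \<union> (B - {z}) = P" using AB(3) z(2) by blast
    moreover have "\<forall>a\<in>A - {z}. \<forall>b\<in>B - {z}. fst a < fst b" using AB(4) by simp
    moreover have "(\<forall>a\<in>A - {z}. \<forall>b\<in>B - {z}. snd a < snd b) \<or> (\<forall>a\<in>A - {z}. \<forall>b\<in>B - {z}. snd b < snd a)"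
      using AB(5) by auto
    ultimately have "decomposable P" by (rule decomposableI)
    thus False using indec by blast
  qed
qed

subsection \<open>Insertions that preserve avoidance\<close>

lemma below_gap:
  fixes S :: "real set"
  assumes "finite S"
  obtains v where "v < w" "\<And>s. s \<in> S \<Longrightarrow> s < w \<Longrightarrow> s < v"
proof (cases "{s \<in> S. s < w} = {}")
  case True
  thus ?thesis using that[of "w - 1"] by auto
next
  case False
  hence "Max {s \<in> S. s < w} < w" using assms by (subst Max_less_iff) auto
  then obtain v where v: "Max {s \<in> S. s < w} < v" "v < w" using dense by blast
  show ?thesis
  proof (rule that[OF v(2)])
    fix s assume "s \<in> S" "s < w"
    hence "s \<le> Max {s \<in> S. s < w}" using assms by (intro Max_ge) auto
    thus "s < v" using v by simp
  qed
qed

text \<open>No point of \<open>P\<close> lies below and to the left of \<open>z\<close>, so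
  \<open>z\<close> can only play the entry \<open>a\<close>. It is then redirected to
  \<open>m\<close>: the other entries are right of \<open>z\<close>, hence of \<open>m\<close>, and
  above \<open>z\<close> they are also above \<open>m\<close>, because no height occurs between the
  two and \<open>m\<close> is not right of \<open>z\<close>.\<close>

lemma insert_minimum_avoids:
  assumes P: "generic P" and Q: "bondless_wedge Q a b d" and av: "\<not> emb Q P"
    and m: "m \<in> P" "fst m < fst z" "snd z < snd m"
    and gap: "\<And>p. p \<in> P \<Longrightarrow> snd p < snd m \<Longrightarrow> snd p < snd z"
    and low: "\<And>p. p \<in> P \<Longrightarrow> fst p < fst z \<Longrightarrow> snd m \<le> snd p"
  shows "\<not> emb Q (insert z P)"
proof
  assume "emb Q (insert z P)"
  then obtain f where f: "f ` Q \<subseteq> insert z P" "order_preserving f Q" unfolding emb_def by blast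
  have gQ: "generic Q" and aQ: "a \<in> Q" using Q unfolding bondless_wedge_def by auto
  have aless: "fst a < fst p" "snd a < snd p" if "p \<in> Q" "p \<noteq> a" for p
    using Q that unfolding bondless_wedge_def by auto
  note iff = order_preserving_iff[OF gQ f(2)]
  have "z \<in> f ` Q"
  proof (rule ccontr)
    assume "z \<notin> f ` Q" hence "f ` Q \<subseteq> P" using f by blast
    thus False using f(2) av unfolding emb_def by blast
  qed
  then obtain k where k: "k \<in> Q" "f k = z" by blast
  have "k = a"
  proof (rule ccontr)
    assume "k \<noteq> a"
    hence "fst (f a) < fst z" "snd (f a) < snd z" using iff aless k aQ by metis+
    moreover from this have "f a \<in> P" using f(1) aQ by auto
    ultimately show False using low m by fastforce
  qed
  have inP: "f p \<in> P" if "p \<in> Q" "p \<noteq> a" for p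
    using f(1) that order_preserving_inj[OF gQ f(2)] k \<open>k = a\<close> by (metis image_subset_iff inj_onD insertE)
  have "emb Q P"
  proof (rule emb_replace[OF gQ f k m(1)])
    fix p assume p: "p \<in> Q"
    show "fst (f p) < fst m" if "fst p < fst k" using aless[OF p] that \<open>k = a\<close> by fastforce
    show "snd (f p) < snd m" if "snd p < snd k" using aless[OF p] that \<open>k = a\<close> by fastforce
    show "fst m < fst (f p)" if "fst k < fst p"
      using that iff[OF k(1) p] k(2) m by auto
    show "snd m < snd (f p)" if "snd k < snd p"
    proof -
      have ne: "p \<noteq> a" using that \<open>k = a\<close> by auto
      have "snd z < snd (f p)" "fst z < fst (f p)"
        using that iff[OF k(1) p] k(2) aless[OF p ne] \<open>k = a\<close> by auto
      moreover have "f p \<noteq> m" using calculation m by auto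
      ultimately show ?thesis using gap inP[OF p ne] m generic_eq[OF P inP[OF p ne] m(1)] by fastforce
    qed
  qed
  thus False using av by blast
qed

text \<open>The redirection depends on the entry \<open>k\<close> played by \<open>z\<close>:
  \<open>a\<close> is moved to \<open>l\<close> inside \<open>I\<close>, any other entry to
  \<open>w\<close>. Where the image \<open>q\<close> of \<open>a\<close> lies relative to
  \<open>I\<close> controls which points can interfere. The only real conflict is a copy that uses
  \<open>w\<close> as well, and the bond condition excludes it.\<close>

lemma insert_below_corner_avoids:
  assumes P: "generic P" and Q: "bondless_wedge Q a b d" and av: "\<not> emb Q P" and I: "block P I"
    and SW: "\<And>p. p \<in> P \<Longrightarrow> \<not> (\<forall>i\<in>I. fst p < fst i \<and> snd p < snd i)"
    and w: "w \<in> P" "\<And>i. i \<in> I \<Longrightarrow> fst i < fst w \<and> snd i < snd w"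
    and leftmost: "\<And>p. p \<in> P \<Longrightarrow> (\<forall>i\<in>I. fst i < fst p \<and> snd i < snd p) \<Longrightarrow> fst w \<le> fst p"
    and l: "l \<in> I" "fst l < fst z"
    and r: "r \<in> I" "fst z < fst r" "\<And>i. i \<in> I \<Longrightarrow> fst i \<le> fst r"
    and xgap: "\<And>p. p \<in> P \<Longrightarrow> fst p < fst r \<Longrightarrow> fst p < fst z"
    and z: "snd z < snd w" and ygap: "\<And>p. p \<in> P \<Longrightarrow> snd p < snd w \<Longrightarrow> snd p < snd z"
  shows "\<not> emb Q (insert z P)"
proof
  assume "emb Q (insert z P)"
  then obtain f where f: "f ` Q \<subseteq> insert z P" "order_preserving f Q" unfolding emb_def by blast
  have gQ: "generic Q" and Qel: "a \<in> Q" "b \<in> Q" "d \<in> Q" "a \<noteq> b" "a \<noteq> d"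
    using Q unfolding bondless_wedge_def by blast+
  have aless: "fst a < fst p \<and> snd a < snd p" if "p \<in> Q" "p \<noteq> a" for p
    using Q that unfolding bondless_wedge_def by blast
  have bless: "fst b < fst p \<and> snd p < snd b" if "p \<in> Q" "p \<noteq> a" "p \<noteq> b" for p
    using Q that unfolding bondless_wedge_def by blast
  have dless: "fst p < fst d \<and> snd d < snd p" if "p \<in> Q" "p \<noteq> a" "p \<noteq> d" for p
    using Q that unfolding bondless_wedge_def by blast
  obtain g where g: "g \<in> Q" "g \<noteq> a" "g \<noteq> b" "g \<noteq> d" using Q unfolding bondless_wedge_def by blast
  have bond: "\<exists>s\<in>Q. fst p < fst s \<and> fst s < fst q \<or> snd p < snd s \<and> snd s < snd q"
    if "p \<in> Q" "p \<noteq> a" "q \<in> Q" "fst p < fst q" "snd p < snd q" for p q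
    using Q that unfolding bondless_wedge_def by blast
  note iff = order_preserving_iff[OF gQ f(2)]
  have IP: "I \<subseteq> P" using I unfolding block_def by blast
  have "z \<in> f ` Q"
  proof (rule ccontr)
    assume "z \<notin> f ` Q" hence "f ` Q \<subseteq> P" using f by blast
    thus False using f(2) av unfolding emb_def by blast
  qed
  then obtain k where k: "k \<in> Q" "f k = z" by blast
  have inP: "f p \<in> P" if "p \<in> Q" "p \<noteq> k" for p
    using f(1) that order_preserving_inj[OF gQ f(2)] k by (metis image_subset_iff inj_onD insertE)
  have Iz: "snd i < snd z" if "i \<in> I" for i using ygap w that IP by blast
  have wr: "fst r < fst w" using w r by blast
  have le_r: "fst r \<le> fst p" if "p \<in> P" "fst z < fst p" for p using xgap that by fastforce
  have le_w: "snd w \<le> snd p" if "p \<in> P" "snd z < snd p" for p using ygap that by fastforce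
  have eq: "p = q" if "p \<in> P" "q \<in> P" "fst p = fst q" for p q using generic_eq[OF P] that by blast
  \<comment> \<open>Since \<open>z\<close> sits in the gap just left of \<open>r\<close>, a point
    right of \<open>z\<close> and outside \<open>I\<close> is right of all of \<open>I\<close>; one
    point of \<open>I\<close> below it puts it into the upper right quadrant, whose leftmost point
    is \<open>w\<close>.\<close>
  have NE: "fst w \<le> fst p" if p: "p \<in> P" "p \<notin> I" "fst z < fst p" "j \<in> I" "snd j < snd p" for p j
  proof -
    have "\<forall>i\<in>I. fst i < fst p"
      using block_side(1)[OF P I p(1,2)] le_r[OF p(1,3)] r(1) by fastforce
    moreover have "\<forall>i\<in>I. snd i < snd p"
      using block_side(2)[OF P I p(1,2)] p(4,5) by fastforce
    ultimately show ?thesis using leftmost p(1) by blast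
  qed
  show False
  proof (cases "k = a")
    case True
    have "emb Q P"
    proof (rule emb_replace[OF gQ f k, of l])
      show "l \<in> P" using l IP by blast
      fix p assume p: "p \<in> Q"
      show "fst (f p) < fst l" if "fst p < fst k" using aless[OF p] that True by fastforce
      show "snd (f p) < snd l" if "snd p < snd k" using aless[OF p] that True by fastforce
      show "fst l < fst (f p)" if "fst k < fst p" using that iff[OF k(1) p] k(2) l by auto
      show "snd l < snd (f p)" if "snd k < snd p" using that iff[OF k(1) p] k(2) Iz[OF l(1)] by auto
    qed
    thus False using av by blast
  next
    case False
    define q where "q = f a"
    have qP: "q \<in> P" and qz: "fst q < fst z" "snd q < snd z"
      using inP[OF Qel(1)] False iff[OF Qel(1) k(1)] aless[OF k(1)] k unfolding q_def by auto
    have qless: "fst q < fst (f p)" "snd q < snd (f p)" if "p \<in> Q" "p \<noteq> a" for p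
      using iff[OF Qel(1) that(1)] aless[OF that] unfolding q_def by auto
    show False
    proof (cases "q \<in> I")
      case True
      \<comment> \<open>Otherwise the image of \<open>b\<close> would be above \<open>z\<close> and
        horizontally between \<open>q\<close> and \<open>r\<close>, hence in \<open>I\<close>, which
        lies below \<open>z\<close>.\<close>
      have "k = b"
      proof (rule ccontr)
        assume kb: "k \<noteq> b"
        have bP: "f b \<in> P" using inP[OF Qel(2)] kb by auto
        have fb: "fst (f b) < fst z" "snd z < snd (f b)"
          using iff[OF Qel(2) k(1)] iff[OF k(1) Qel(2)] bless[OF k(1) False kb] k by auto
        have "f b \<in> I" using blockD(1)[OF I True r(1) bP] qless[OF Qel(2)] Qel fb r by auto
        thus False using Iz fb by fastforce
      qed
      have sub: "fst z < fst (f p)" "snd (f p) < snd z" "f p \<in> P" if "p \<in> Q" "p \<noteq> a" "p \<noteq> b" for p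
        using bless[OF that] that iff[OF k(1) that(1)] iff[OF that(1) k(1)] inP[OF that(1)] k \<open>k = b\<close>
        by auto
      have db: "d \<noteq> b"
      proof
        assume "d = b"
        hence "fst g < fst b" using dless[OF g(1,2,4)] by simp
        thus False using bless[OF g(1-3)] by simp
      qed
      \<comment> \<open>The only point of \<open>I\<close> to the right of \<open>z\<close> is
        \<open>r\<close>. An entry sitting there must be \<open>d\<close>, since otherwise
        \<open>d\<close> would fall into \<open>I\<close> further right than \<open>r\<close>; but
        then \<open>g\<close> has no place between \<open>z\<close> and \<open>r\<close>.\<close>
      have notI: "f p \<notin> I" if p: "p \<in> Q" "p \<noteq> a" "p \<noteq> b" for p
      proof
        assume pI: "f p \<in> I"
        have "fst (f p) = fst r" using le_r[OF sub(3)[OF p] sub(1)[OF p]] r(3)[OF pI] by simp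
        moreover have "r \<in> P" using IP r(1) by blast
        ultimately have fpr: "f p = r" using eq[OF sub(3)[OF p]] by blast
        have pd: "p = d"
        proof (rule ccontr)
          assume pd: "p \<noteq> d"
          have fd: "fst r < fst (f d)" "snd (f d) < snd r"
            using dless[OF p(1,2) pd] iff[OF p(1) Qel(3)] iff[OF Qel(3) p(1)] fpr by auto
          have "snd q < snd (f d)" using qless[of d] Qel by auto
          hence "f d \<in> I" using blockD(2)[OF I True r(1) sub(3)[OF Qel(3) _ db]] Qel fd by auto
          thus False using r(3) fd by fastforce
        qed
        have "fst (f g) < fst r"
          using dless[OF g(1,2,4)] iff[OF g(1) Qel(3)] fpr pd by auto
        thus False using le_r[OF sub(3)[OF g(1-3)] sub(1)[OF g(1-3)]] by auto
      qed
      have wless: "fst w < fst (f p) \<and> snd (f p) < snd w" if p: "p \<in> Q" "p \<noteq> a" "p \<noteq> b" for p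
      proof -
        have "fst w \<le> fst (f p)"
          by (rule NE[OF sub(3)[OF p] notI[OF p] sub(1)[OF p] True qless(2)[OF p(1,2)]])
        moreover have "f p \<noteq> w" using sub(2)[OF p] z by auto
        ultimately show ?thesis using eq[OF sub(3)[OF p] w(1)] sub(2)[OF p] z by force
      qed
      have qw: "fst q < fst w" "snd q < snd w" using w True by auto
      have "emb Q P"
      proof (rule emb_replace[OF gQ f k w(1)])
        fix p assume p: "p \<in> Q"
        have c: "p = a \<or> p = b \<or> fst b < fst p \<and> snd p < snd b" using bless[OF p] by blast
        note bl = aless[OF Qel(2)]
        show "fst (f p) < fst w" if "fst p < fst k"
          using c that \<open>k = b\<close> qw unfolding q_def by auto
        show "snd (f p) < snd w" if "snd p < snd k"
          using c that \<open>k = b\<close> qw wless[OF p] unfolding q_def by auto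
        show "fst w < fst (f p)" if "fst k < fst p"
        proof -
          have "p \<noteq> a" "p \<noteq> b" using that \<open>k = b\<close> bl Qel(4) by auto
          thus ?thesis using wless[OF p] by simp
        qed
        show "snd w < snd (f p)" if "snd k < snd p"
          using c that \<open>k = b\<close> bl Qel by auto
      qed
      thus False using av by blast
    next
      case qI: False
      have ql: "\<forall>i\<in>I. fst q < fst i"
      proof -
        have "fst q < fst r" using qz r by auto
        thus ?thesis using block_side(1)[OF P I qP qI] r(1) by fastforce
      qed
      hence qa: "\<forall>i\<in>I. snd i < snd q"
        using block_side(2)[OF P I qP qI] SW[OF qP] by blast
      have side: "fst (f p) < fst z \<or> fst w \<le> fst (f p)" if p: "p \<in> Q" "p \<noteq> k" for p
      proof (rule ccontr)
        assume n: "\<not> ?thesis"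
        have fp: "f p \<in> P" using inP p by blast
        have pa: "p \<noteq> a" using n qz(1) unfolding q_def by auto
        have hi: "snd r < snd (f p)" using qa qless(2)[OF p(1) pa] r(1) by force
        have "f p \<notin> I"
        proof
          assume "f p \<in> I"
          thus False using qa qless(2)[OF p(1) pa] by force
        qed
        moreover have "fst z \<noteq> fst (f p)"
          using iff(1)[OF k(1) p(1)] iff(1)[OF p(1) k(1)] generic_eq[OF gQ k(1) p(1)] p(2) k(2) by force
        ultimately have "fst w \<le> fst (f p)" using NE[OF fp _ _ r(1) hi] n by force
        thus False using n by blast
      qed
      have vside: "snd (f p) < snd z \<or> snd w \<le> snd (f p)" if p: "p \<in> Q" "p \<noteq> k" for p
      proof -
        have "snd z \<noteq> snd (f p)"
          using iff(2)[OF k(1) p(1)] iff(2)[OF p(1) k(1)] generic_eq[OF gQ k(1) p(1)] p(2) k(2) by force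
        thus ?thesis using le_w[OF inP[OF p]] by force
      qed
      have zw: "fst z < fst w" using r wr by auto
      show False
      proof (cases "w \<in> f ` Q")
        \<comment> \<open>No entry of the copy separates \<open>z\<close> from \<open>w\<close> in
          either direction, so \<open>k\<close> and \<open>k'\<close> would form an increasing bond
          that avoids \<open>a\<close>.\<close>
        case True
        then obtain k' where k': "k' \<in> Q" "f k' = w" by blast
        have kk: "fst k < fst k'" "snd k < snd k'" using iff[OF k(1) k'(1)] k k' zw z by auto
        obtain s where s: "s \<in> Q" "fst k < fst s \<and> fst s < fst k' \<or> snd k < snd s \<and> snd s < snd k'"
          using bond[OF k(1) False k'(1) kk] by blast
        have "s \<noteq> k" using s by auto
        show False
          using s(2) side[OF s(1) \<open>s \<noteq> k\<close>] vside[OF s(1) \<open>s \<noteq> k\<close>]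
            iff[OF k(1) s(1)] iff[OF s(1) k'(1)] k(2) k'(2) by auto
      next
        case nw: False
        have strict: "fst (f p) \<noteq> fst w" "snd (f p) \<noteq> snd w" if "p \<in> Q" "p \<noteq> k" for p
          using generic_eq[OF P inP[OF that] w(1)] nw that by (metis image_eqI)+
        have "emb Q P"
        proof (rule emb_replace[OF gQ f k w(1)])
          fix p assume p: "p \<in> Q"
          note iff' = iff[OF k(1) p] iff[OF p k(1)]
          show "fst (f p) < fst w" if "fst p < fst k" using that iff' k(2) zw by auto
          show "snd (f p) < snd w" if "snd p < snd k" using that iff' k(2) z by auto
          show "fst w < fst (f p)" if "fst k < fst p"
          proof -
            have "p \<noteq> k" using that by auto
            thus ?thesis using that iff'(1) k(2) side[OF p] strict(1)[OF p] by force
          qed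
          show "snd w < snd (f p)" if "snd k < snd p"
          proof -
            have "p \<noteq> k" using that by auto
            thus ?thesis using that iff'(2) k(2) vside[OF p] strict(2)[OF p] by force
          qed
        qed
        thus False using av by blast
      qed
    qed
  qed
qed

subsection \<open>Destroying blocks\<close>

text \<open>One insertion step, with the number of blocks as the decreasing measure. Stated as a
  predicate, it can be transported along the reflection.\<close>

definition improvable :: "(real \<times> real) set \<Rightarrow> (real \<times> real) set \<Rightarrow> bool" where
  "improvable Q P \<longleftrightarrow> (\<exists>z. generic (insert z P) \<and> \<not> emb Q (insert z P) \<and>
     \<not> decomposable (insert z P) \<and> card (blocks (insert z P)) < card (blocks P))"

lemma finite_blocks: "finite P \<Longrightarrow> finite (blocks P)"
  by (rule finite_subset[of _ "Pow P"]) (auto simp: blocks_def block_def)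

section \<open>Invariance under reflection in the diagonal\<close>

lemma swap_swap_image [simp]: "prod.swap ` prod.swap ` P = P"
  by (simp add: image_image)

lemma swap_eq_iff: "prod.swap x = prod.swap y \<longleftrightarrow> x = y"
  by (metis swap_swap)

lemma generic_swap: "generic P \<Longrightarrow> generic (prod.swap ` P)"
  unfolding generic_def by (auto simp: inj_on_def)

lemma emb_swap: "emb Q P \<Longrightarrow> emb (prod.swap ` Q) (prod.swap ` P)"
  unfolding emb_def
proof clarify
  fix f assume "f ` Q \<subseteq> P" "order_preserving f Q"
  hence "(prod.swap \<circ> f \<circ> prod.swap) ` prod.swap ` Q \<subseteq> prod.swap ` P"
    "order_preserving (prod.swap \<circ> f \<circ> prod.swap) (prod.swap ` Q)"
    unfolding order_preserving_def by (auto simp: image_subset_iff)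
  thus "\<exists>g. g ` prod.swap ` Q \<subseteq> prod.swap ` P \<and> order_preserving g (prod.swap ` Q)" by blast
qed

lemma emb_swap_iff: "emb (prod.swap ` Q) (prod.swap ` P) \<longleftrightarrow> emb Q P"
  using emb_swap[of Q P] emb_swap[of "prod.swap ` Q" "prod.swap ` P"] by auto

lemma decomposable_swap: "decomposable P \<Longrightarrow> decomposable (prod.swap ` P)"
proof -
  assume "decomposable P"
  then obtain A B where AB: "A \<noteq> {}" "B \<noteq> {}" "A \<union> B = P" "\<forall>a\<in>A. \<forall>b\<in>B. fst a < fst b"
    "(\<forall>a\<in>A. \<forall>b\<in>B. snd a < snd b) \<or> (\<forall>a\<in>A. \<forall>b\<in>B. snd b < snd a)"
    unfolding decomposable_def by blast
  from AB(5) show ?thesis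
  proof
    assume "\<forall>a\<in>A. \<forall>b\<in>B. snd a < snd b"
    thus ?thesis using AB by (intro decomposableI[of "prod.swap ` A" "prod.swap ` B"]) auto
  next
    assume "\<forall>a\<in>A. \<forall>b\<in>B. snd b < snd a"
    thus ?thesis using AB by (intro decomposableI[of "prod.swap ` B" "prod.swap ` A"]) auto
  qed
qed

lemma decomposable_swap_iff: "decomposable (prod.swap ` P) \<longleftrightarrow> decomposable P"
  using decomposable_swap[of P] decomposable_swap[of "prod.swap ` P"] by auto

lemma blocks_swap: "I \<in> blocks P \<Longrightarrow> prod.swap ` I \<in> blocks (prod.swap ` P)"
proof -
  assume I: "I \<in> blocks P"
  hence b: "block P I" and ne: "I \<noteq> P" "\<exists>p\<in>I. \<exists>q\<in>I. p \<noteq> q" unfolding blocks_def by auto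
  have "I \<subseteq> P" using b unfolding block_def by blast
  have "block (prod.swap ` P) (prod.swap ` I)"
    unfolding block_def
  proof (intro conjI ballI impI)
    show "prod.swap ` I \<subseteq> prod.swap ` P" using \<open>I \<subseteq> P\<close> by blast
    fix p u v assume h: "p \<in> prod.swap ` P" "u \<in> prod.swap ` I" "v \<in> prod.swap ` I"
    then obtain p' u' v' where e: "p = prod.swap p'" "p' \<in> P" "u = prod.swap u'" "u' \<in> I"
      "v = prod.swap v'" "v' \<in> I" by blast
    show "p \<in> prod.swap ` I" if "fst u < fst p \<and> fst p < fst v"
      using blockD(2)[OF b e(4,6,2)] that e by (intro image_eqI[of _ _ p']) simp_all
    show "p \<in> prod.swap ` I" if "snd u < snd p \<and> snd p < snd v"
      using blockD(1)[OF b e(4,6,2)] that e by (intro image_eqI[of _ _ p']) simp_all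
  qed
  moreover have "prod.swap ` I \<noteq> prod.swap ` P" using ne by (simp add: inj_image_eq_iff)
  moreover have "\<exists>p\<in>prod.swap ` I. \<exists>q\<in>prod.swap ` I. p \<noteq> q" using ne(2) by (simp add: swap_eq_iff)
  ultimately show ?thesis unfolding blocks_def by blast
qed

lemma blocks_swap_eq: "blocks (prod.swap ` P) = (`) prod.swap ` blocks P"
proof
  show "blocks (prod.swap ` P) \<subseteq> (`) prod.swap ` blocks P"
  proof
    fix J assume "J \<in> blocks (prod.swap ` P)"
    hence "prod.swap ` J \<in> blocks P" using blocks_swap[of J "prod.swap ` P"] by simp
    thus "J \<in> (`) prod.swap ` blocks P" by (intro image_eqI[of _ _ "prod.swap ` J"]) simp_all
  qed
qed (use blocks_swap in blast)

lemma card_blocks_swap: "card (blocks (prod.swap ` P)) = card (blocks P)"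
proof -
  have "inj_on ((`) prod.swap) (blocks P)" by (rule inj_onI) (simp add: inj_image_eq_iff)
  thus ?thesis unfolding blocks_swap_eq by (rule card_image)
qed

lemma bondless_wedge_swap:
  assumes "bondless_wedge Q a b d"
  shows "bondless_wedge (prod.swap ` Q) (prod.swap a) (prod.swap d) (prod.swap b)"
proof -
  have diff: "prod.swap ` S - {prod.swap x} = prod.swap ` (S - {x})"
    "prod.swap ` S - {prod.swap x, prod.swap y} = prod.swap ` (S - {x, y})" for S and x y :: "real \<times> real"
    by (simp_all add: image_set_diff)
  show ?thesis
    using assms unfolding bondless_wedge_def diff ball_simps bex_simps fst_swap snd_swap
    apply (intro conjI)
    subgoal by (rule generic_swap) blast
    subgoal by blast
    subgoal by blast
    subgoal by blast
    subgoal by (simp add: swap_eq_iff)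
    subgoal by (simp add: swap_eq_iff)
    subgoal by (simp add: swap_eq_iff) blast
    subgoal by blast
    subgoal by blast
    subgoal by blast
    subgoal by blast
    done
qed

lemma improvable_swap: "improvable (prod.swap ` Q) (prod.swap ` P) \<Longrightarrow> improvable Q P"
proof -
  assume "improvable (prod.swap ` Q) (prod.swap ` P)"
  then obtain z where z: "generic (insert z (prod.swap ` P))"
    "\<not> emb (prod.swap ` Q) (insert z (prod.swap ` P))"
    "\<not> decomposable (insert z (prod.swap ` P))"
    "card (blocks (insert z (prod.swap ` P))) < card (blocks (prod.swap ` P))"
    unfolding improvable_def by blast
  have e: "insert z (prod.swap ` P) = prod.swap ` insert (prod.swap z) P" by simp
  have "generic (insert (prod.swap z) P)" using generic_swap[OF z(1)] by simp
  thus ?thesis using z(2-4) unfolding improvable_def e emb_swap_iff decomposable_swap_iff card_blocks_swap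
    by blast
qed

section \<open>Choosing the inserted point\<close>

lemma improvableI:
  assumes P: "generic P" and fresh: "fst z \<notin> fst ` P" "snd z \<notin> snd ` P"
    and I: "I \<in> blocks P" and max: "\<And>J. J \<in> blocks P \<Longrightarrow> I \<subseteq> J \<Longrightarrow> J = I"
    and indec: "\<not> decomposable P"
    and lr: "l \<in> I" "r \<in> I" "fst l < fst z" "fst z < fst r"
    and y: "y \<in> P" "y \<notin> I"
      "(\<forall>i\<in>I. snd i < snd y \<and> snd y < snd z) \<or> (\<forall>i\<in>I. snd z < snd y \<and> snd y < snd i)"
    and av: "\<not> emb Q (insert z P)"
  shows "improvable Q P"
proof -
  have z: "generic (insert z P)" "z \<notin> P" using P fresh unfolding generic_def by auto
  note cut = cut_step[OF P z I max indec lr y]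
  have "finite (blocks P)" using P finite_blocks unfolding generic_def by blast
  hence "card (blocks (insert z P)) < card (blocks P)"
    using cut(1) I by (intro psubset_card_mono) auto
  thus ?thesis using z cut(2) av unfolding improvable_def by blast
qed

lemma block_extremes:
  assumes P: "generic P" and I: "I \<in> blocks P"
  obtains l r where "l \<in> I" "r \<in> I" "fst l < fst r" "\<And>i. i \<in> I \<Longrightarrow> fst i \<le> fst r"
proof -
  have IP: "I \<subseteq> P" using I unfolding blocks_def block_def by blast
  hence fin: "finite (fst ` I)" using P unfolding generic_def by (metis finite_imageI finite_subset)
  obtain p q where pq: "p \<in> I" "q \<in> I" "p \<noteq> q" using I unfolding blocks_def by blast
  have "Max (fst ` I) \<in> fst ` I" using fin pq by (intro Max_in) auto
  then obtain r where r: "r \<in> I" "fst r = Max (fst ` I)" by auto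
  have le: "fst i \<le> fst r" if "i \<in> I" for i using r fin that by simp
  obtain l where l: "l \<in> I" "l \<noteq> r" using pq by blast
  have "fst l < fst r" using le[OF l(1)] generic_eq[OF P, of l r] l r IP by force
  thus ?thesis using that l r le by blast
qed

text \<open>Makes precise what it means to be just left of \<open>p\<close> and just below
  \<open>q\<close>: no coordinate of \<open>P\<close> falls into either gap. The two coordinates are
  chosen independently.\<close>

lemma fresh_below:
  assumes "finite P" "p \<in> (P :: (real \<times> real) set)" "q \<in> P"
  obtains z where "fst z \<notin> fst ` P" "snd z \<notin> snd ` P" "fst z < fst p" "snd z < snd q"
    "\<And>s. s \<in> P \<Longrightarrow> fst s < fst p \<Longrightarrow> fst s < fst z" "\<And>s. s \<in> P \<Longrightarrow> snd s < snd q \<Longrightarrow> snd s < snd z"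
proof -
  obtain x where x: "x < fst p" "\<And>s. s \<in> fst ` P \<Longrightarrow> s < fst p \<Longrightarrow> s < x"
    using below_gap[of "fst ` P" "fst p"] assms(1) by blast
  obtain v where v: "v < snd q" "\<And>s. s \<in> snd ` P \<Longrightarrow> s < snd q \<Longrightarrow> s < v"
    using below_gap[of "snd ` P" "snd q"] assms(1) by blast
  show ?thesis
  proof (rule that[of "(x, v)"])
    show "fst (x, v) \<notin> fst ` P" using x by fastforce
    show "snd (x, v) \<notin> snd ` P" using v by fastforce
  qed (use x v in auto)
qed

lemma improvable_lower:
  assumes P: "generic P" and Q: "bondless_wedge Q a b d" and av: "\<not> emb Q P"
    and indec: "\<not> decomposable P"
    and I: "I \<in> blocks P" and max: "\<And>J. J \<in> blocks P \<Longrightarrow> I \<subseteq> J \<Longrightarrow> J = I"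
    and s: "s \<in> P" "\<forall>i\<in>I. fst s < fst i \<and> snd s < snd i"
  shows "improvable Q P"
proof -
  obtain l r where lr: "l \<in> I" "r \<in> I" "fst l < fst r" "\<And>i. i \<in> I \<Longrightarrow> fst i \<le> fst r"
    using block_extremes[OF P I] by blast
  have IP: "block P I" "I \<subseteq> P" using I unfolding blocks_def block_def by blast+
  have fin: "finite P" using P unfolding generic_def by blast
  \<comment> \<open>These are exactly the points that will be left of \<open>z\<close>, some of them
    in \<open>I\<close>. As \<open>s\<close> is among them and below \<open>I\<close>, so is the
    minimum \<open>m\<close>, which serves both as target of the redirection and as separating
    point.\<close>
  define S where "S = {p \<in> P. fst p < fst r}"
  have sS: "s \<in> S" using s lr(2) unfolding S_def by blast
  have finS: "finite (snd ` S)" using fin unfolding S_def by simp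
  have "Min (snd ` S) \<in> snd ` S" using finS sS by (intro Min_in) auto
  then obtain m where m: "m \<in> S" "snd m = Min (snd ` S)" by auto
  have low: "snd m \<le> snd p" if "p \<in> P" "fst p < fst r" for p
    using m(2) finS that unfolding S_def by simp
  have mP: "m \<in> P" "fst m < fst r" using m(1) unfolding S_def by auto
  have ms: "snd m < snd i" if "i \<in> I" for i
    using low[of s] s sS that unfolding S_def by force
  obtain z where z: "fst z \<notin> fst ` P" "snd z \<notin> snd ` P" "fst z < fst r" "snd z < snd m"
    "\<And>s. s \<in> P \<Longrightarrow> fst s < fst r \<Longrightarrow> fst s < fst z" "\<And>s. s \<in> P \<Longrightarrow> snd s < snd m \<Longrightarrow> snd s < snd z"
    using fresh_below[OF fin, of r m] mP IP lr(2) by blast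
  show ?thesis
  proof (rule improvableI[OF P z(1,2) I max indec lr(1,2) _ z(3) mP(1)])
    show "fst l < fst z" using z(5) lr IP by blast
    show "m \<notin> I" using ms by blast
    show "(\<forall>i\<in>I. snd i < snd m \<and> snd m < snd z) \<or> (\<forall>i\<in>I. snd z < snd m \<and> snd m < snd i)"
      using ms z(4) by blast
    show "\<not> emb Q (insert z P)"
      by (rule insert_minimum_avoids[OF P Q av mP(1) z(5)[OF mP] z(4) z(6)])
        (use low z(3) in force)+
  qed
qed

text \<open>The point \<open>y\<close>, higher than \<open>I\<close> and lower than
  \<open>w\<close>, does the separating: \<open>z\<close> is placed just below \<open>w\<close>,
  hence still above \<open>y\<close>.\<close>

lemma improvable_corner:
  assumes P: "generic P" and Q: "bondless_wedge Q a b d" and av: "\<not> emb Q P"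
    and indec: "\<not> decomposable P"
    and I: "I \<in> blocks P" and max: "\<And>J. J \<in> blocks P \<Longrightarrow> I \<subseteq> J \<Longrightarrow> J = I"
    and SW: "\<And>p. p \<in> P \<Longrightarrow> \<not> (\<forall>i\<in>I. fst p < fst i \<and> snd p < snd i)"
    and w: "w \<in> P" "\<And>i. i \<in> I \<Longrightarrow> fst i < fst w \<and> snd i < snd w"
    and leftmost: "\<And>p. p \<in> P \<Longrightarrow> (\<forall>i\<in>I. fst i < fst p \<and> snd i < snd p) \<Longrightarrow> fst w \<le> fst p"
    and y: "y \<in> P" "\<forall>i\<in>I. snd i < snd y" "snd y < snd w"
  shows "improvable Q P"
proof -
  obtain l r where lr: "l \<in> I" "r \<in> I" "fst l < fst r" "\<And>i. i \<in> I \<Longrightarrow> fst i \<le> fst r"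
    using block_extremes[OF P I] by blast
  have IP: "block P I" "I \<subseteq> P" using I unfolding blocks_def block_def by blast+
  have fin: "finite P" using P unfolding generic_def by blast
  obtain z where z: "fst z \<notin> fst ` P" "snd z \<notin> snd ` P" "fst z < fst r" "snd z < snd w"
    "\<And>s. s \<in> P \<Longrightarrow> fst s < fst r \<Longrightarrow> fst s < fst z" "\<And>s. s \<in> P \<Longrightarrow> snd s < snd w \<Longrightarrow> snd s < snd z"
    using fresh_below[OF fin, of r w] w(1) IP lr(2) by blast
  have lz: "fst l < fst z" using z(5) lr IP by blast
  show ?thesis
  proof (rule improvableI[OF P z(1,2) I max indec lr(1,2) lz z(3) y(1)])
    show "y \<notin> I" using y(2) by blast
    show "(\<forall>i\<in>I. snd i < snd y \<and> snd y < snd z) \<or> (\<forall>i\<in>I. snd z < snd y \<and> snd y < snd i)"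
      using y(2) z(6)[OF y(1,3)] by blast
    show "\<not> emb Q (insert z P)"
      by (rule insert_below_corner_avoids[OF P Q av IP(1) SW w leftmost lr(1) lz lr(2) z(3) lr(4) z(5) z(4) z(6)])
  qed
qed

text \<open>If the lower left quadrant of a maximal block \<open>I\<close> is empty,
  indecomposability makes the upper right quadrant \<open>N\<close> nonempty, with leftmost point
  \<open>w\<close> and lowest point \<open>w'\<close>. A point above \<open>I\<close> but below
  \<open>w\<close>, or right of \<open>I\<close> but left of \<open>w'\<close>, allows a corner
  insertion, directly or reflected. Without such a point \<open>w\<close> could be added to
  \<open>I\<close>, against maximality or indecomposability.\<close>

lemma improvable_if_blocks:
  assumes P: "generic P" and Q: "bondless_wedge Q a b d" and av: "\<not> emb Q P"
    and indec: "\<not> decomposable P" and ne: "blocks P \<noteq> {}"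
  shows "improvable Q P"
proof -
  have fin: "finite P" using P unfolding generic_def by blast
  obtain I where I: "I \<in> blocks P" and max0: "\<forall>J\<in>blocks P. I \<subseteq> J \<longrightarrow> I = J"
    using finite_has_maximal[OF finite_blocks[OF fin] ne] by blast
  have max: "J = I" if "J \<in> blocks P" "I \<subseteq> J" for J using max0 that by blast
  have b: "block P I" and neP: "I \<noteq> P" and Ine: "I \<noteq> {}" using I unfolding blocks_def by blast+
  have IP: "I \<subseteq> P" using b unfolding block_def by blast
  show ?thesis
  proof (cases "\<exists>s\<in>P. \<forall>i\<in>I. fst s < fst i \<and> snd s < snd i")
    case True
    thus ?thesis using improvable_lower[OF P Q av indec I max] by blast
  next
    case SW: False
    define N where "N = {p \<in> P. \<forall>i\<in>I. fst i < fst p \<and> snd i < snd p}"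
    define NW where "NW = {p \<in> P. \<forall>i\<in>I. fst p < fst i \<and> snd i < snd p}"
    define SE where "SE = {p \<in> P. \<forall>i\<in>I. fst i < fst p \<and> snd p < snd i}"
    have parts: "p \<in> N \<or> p \<in> NW \<or> p \<in> SE" if p: "p \<in> P" "p \<notin> I" for p
      using block_side[OF P b p] SW p(1) unfolding N_def NW_def SE_def by blast
    have "N \<noteq> {}"
    proof
      assume N: "N = {}"
      obtain i where i: "i \<in> I" using Ine by blast
      have cross: "fst p < fst q \<and> snd q < snd p" if "p \<in> NW" "q \<in> SE" for p q
        using that i unfolding NW_def SE_def by fastforce
      \<comment> \<open>With \<open>N\<close> empty, \<open>NW\<close>, \<open>I\<close> and
        \<open>SE\<close> descend from left to right, so \<open>P\<close> would be a skew
        sum.\<close>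
      have P_eq: "P = NW \<union> (I \<union> SE)"
        using parts N IP unfolding NW_def SE_def by blast
      show False
      proof (cases "NW = {}")
        case False
        have "\<forall>a\<in>NW. \<forall>b\<in>I \<union> SE. fst a < fst b" "\<forall>a\<in>NW. \<forall>b\<in>I \<union> SE. snd b < snd a"
          using cross unfolding NW_def by blast+
        hence "decomposable P" using False i P_eq decomposableI[of NW "I \<union> SE" P] by blast
        thus False using indec by blast
      next
        case True
        hence "I \<union> SE = P" "SE \<noteq> {}" using P_eq neP by auto
        moreover have "\<forall>a\<in>I. \<forall>b\<in>SE. fst a < fst b" "\<forall>a\<in>I. \<forall>b\<in>SE. snd b < snd a"
          unfolding SE_def by blast+
        ultimately have "decomposable P" using i decomposableI[of I SE P] by blast
        thus False using indec by blast
      qed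
    qed
    have finN: "finite N" using fin unfolding N_def by simp
    obtain w where w: "w \<in> N" "\<And>p. p \<in> N \<Longrightarrow> fst w \<le> fst p"
    proof -
      have "Min (fst ` N) \<in> fst ` N" using finN \<open>N \<noteq> {}\<close> by (intro Min_in) auto
      then obtain w where "w \<in> N" "fst w = Min (fst ` N)" by auto
      thus ?thesis using that[of w] finN by simp
    qed
    obtain w' where w': "w' \<in> N" "\<And>p. p \<in> N \<Longrightarrow> snd w' \<le> snd p"
    proof -
      have "Min (snd ` N) \<in> snd ` N" using finN \<open>N \<noteq> {}\<close> by (intro Min_in) auto
      then obtain w where "w \<in> N" "snd w = Min (snd ` N)" by auto
      thus ?thesis using that[of w] finN by simp
    qed
    have wI: "w \<in> P" "\<And>i. i \<in> I \<Longrightarrow> fst i < fst w \<and> snd i < snd w"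
      and wI': "w' \<in> P" "\<And>i. i \<in> I \<Longrightarrow> fst i < fst w' \<and> snd i < snd w'"
      using w(1) w'(1) unfolding N_def by blast+
    consider (y) y where "y \<in> P" "\<forall>i\<in>I. snd i < snd y" "snd y < snd w"
      | (x) x where "x \<in> P" "\<forall>i\<in>I. fst i < fst x" "fst x < fst w'"
      | (none) "\<And>p. p \<in> P \<Longrightarrow> \<forall>i\<in>I. snd i < snd p \<Longrightarrow> snd w \<le> snd p"
               "\<And>p. p \<in> P \<Longrightarrow> \<forall>i\<in>I. fst i < fst p \<Longrightarrow> fst w' \<le> fst p"
      by (meson not_le)
    thus ?thesis
    proof cases
      case y
      show ?thesis
      proof (rule improvable_corner[OF P Q av indec I max _ wI _ y])
        show "\<not> (\<forall>i\<in>I. fst p < fst i \<and> snd p < snd i)" if "p \<in> P" for p using SW that by blast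
        show "fst w \<le> fst p" if "p \<in> P" "\<forall>i\<in>I. fst i < fst p \<and> snd i < snd p" for p
          using w(2) that unfolding N_def by blast
      qed
    next
      case x
      \<comment> \<open>Reflection turns the lowest point \<open>w'\<close> of the upper right
        quadrant into the leftmost one, and \<open>x\<close> to the left of \<open>w'\<close> into a
        point below it.\<close>
      have "improvable (prod.swap ` Q) (prod.swap ` P)"
      proof (rule improvable_corner[OF generic_swap[OF P] bondless_wedge_swap[OF Q] _ _ blocks_swap[OF I],
            of "prod.swap w'" "prod.swap x"])
        show "\<not> emb (prod.swap ` Q) (prod.swap ` P)" "\<not> decomposable (prod.swap ` P)"
          using av indec emb_swap_iff decomposable_swap_iff by simp_all
        show "J = prod.swap ` I" if "J \<in> blocks (prod.swap ` P)" "prod.swap ` I \<subseteq> J" for J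
        proof -
          obtain K where K: "J = prod.swap ` K" "K \<in> blocks P" using \<open>J \<in> _\<close> blocks_swap_eq by blast
          have "I \<subseteq> K" using that(2) K(1) by (simp add: inj_image_subset_iff)
          thus ?thesis using max[OF K(2)] K(1) by simp
        qed
        show "\<not> (\<forall>i\<in>prod.swap ` I. fst p < fst i \<and> snd p < snd i)" if "p \<in> prod.swap ` P" for p
          using SW that by fastforce
        show "prod.swap w' \<in> prod.swap ` P" "prod.swap x \<in> prod.swap ` P" using wI' x by blast+
        show "fst i < fst (prod.swap w') \<and> snd i < snd (prod.swap w')" if "i \<in> prod.swap ` I" for i
          using wI'(2) that by auto
        show "fst (prod.swap w') \<le> fst p"
          if "p \<in> prod.swap ` P" "\<forall>i\<in>prod.swap ` I. fst i < fst p \<and> snd i < snd p" for p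
        proof -
          have "prod.swap p \<in> N" using that unfolding N_def by auto
          thus ?thesis using w'(2)[of "prod.swap p"] by simp
        qed
        show "\<forall>i\<in>prod.swap ` I. snd i < snd (prod.swap x)" "snd (prod.swap x) < snd (prod.swap w')"
          using x by auto
      qed
      thus ?thesis by (rule improvable_swap)
    next
      case none
      \<comment> \<open>Without separating points \<open>w\<close> is no higher than
        \<open>w'\<close>, the lowest point of \<open>N\<close>; hence the two coincide.\<close>
      have "snd w = snd w'" using none(1)[OF wI'(1)] wI'(2) w'(2)[OF w(1)] by auto
      hence ww: "w' = w" using generic_eq[OF P wI(1) wI'(1)] by simp
      have wnI: "w \<notin> I" using wI(2) by blast
      \<comment> \<open>Outside points have \<open>w\<close> and \<open>I\<close> on the same side
        in both directions. So \<open>insert w I\<close> is a block, by maximality it is all of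
        \<open>P\<close>, and \<open>w\<close> splits off as a sum component.\<close>
      have out: "(fst p < fst w \<and> (\<forall>i\<in>I. fst p < fst i) \<or> fst w < fst p \<and> (\<forall>i\<in>I. fst i < fst p)) \<and>
        (snd p < snd w \<and> (\<forall>i\<in>I. snd p < snd i) \<or> snd w < snd p \<and> (\<forall>i\<in>I. snd i < snd p))"
        if p: "p \<in> P" "p \<notin> I" "p \<noteq> w" for p
      proof -
        obtain i where i: "i \<in> I" using Ine by blast
        have ne: "fst p \<noteq> fst w" "snd p \<noteq> snd w" using generic_eq[OF P p(1) wI(1)] p(3) by blast+
        have "fst p < fst w" if "\<forall>i\<in>I. fst p < fst i" using that i wI(2)[OF i] by force
        moreover have "fst w < fst p" if "\<forall>i\<in>I. fst i < fst p" using none(2)[OF p(1) that] ww ne by simp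
        moreover have "snd p < snd w" if "\<forall>i\<in>I. snd p < snd i" using that i wI(2)[OF i] by force
        moreover have "snd w < snd p" if "\<forall>i\<in>I. snd i < snd p" using none(1)[OF p(1) that] ne by simp
        ultimately show ?thesis using block_side[OF P b p(1,2)] by blast
      qed
      have "block P (insert w I)"
        unfolding block_def
      proof (intro conjI ballI impI)
        show "insert w I \<subseteq> P" using wI IP by blast
        fix p u v assume h: "p \<in> P" "u \<in> insert w I" "v \<in> insert w I"
        show "p \<in> insert w I" if "fst u < fst p \<and> fst p < fst v"
        proof (rule ccontr)
          assume "p \<notin> insert w I"
          hence "(\<forall>i\<in>insert w I. fst p < fst i) \<or> (\<forall>i\<in>insert w I. fst i < fst p)"
            using out[OF h(1)] by blast
          thus False
          proof
            assume "\<forall>i\<in>insert w I. fst p < fst i"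
            from bspec[OF this h(2)] show False using that by simp
          next
            assume "\<forall>i\<in>insert w I. fst i < fst p"
            from bspec[OF this h(3)] show False using that by simp
          qed
        qed
        show "p \<in> insert w I" if "snd u < snd p \<and> snd p < snd v"
        proof (rule ccontr)
          assume "p \<notin> insert w I"
          hence "(\<forall>i\<in>insert w I. snd p < snd i) \<or> (\<forall>i\<in>insert w I. snd i < snd p)"
            using out[OF h(1)] by blast
          thus False
          proof
            assume "\<forall>i\<in>insert w I. snd p < snd i"
            from bspec[OF this h(2)] show False using that by simp
          next
            assume "\<forall>i\<in>insert w I. snd i < snd p"
            from bspec[OF this h(3)] show False using that by simp
          qed
        qed
      qed
      hence "insert w I = P" using max[of "insert w I"] I wnI unfolding blocks_def by blast
      moreover have "\<forall>i\<in>I. \<forall>v\<in>{w}. fst i < fst v" "\<forall>i\<in>I. \<forall>v\<in>{w}. snd i < snd v" using wI(2) by blast+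
      ultimately have "decomposable P" using Ine decomposableI[of I "{w}" P] by simp
      thus ?thesis using indec by blast
    qed
  qed
qed

text \<open>Each insertion enlarges the point set but lowers the number of blocks, on which the
  induction runs.\<close>

lemma ex_blockless_extension:
  assumes "bondless_wedge Q a b d"
  shows "generic P \<Longrightarrow> \<not> emb Q P \<Longrightarrow> \<not> decomposable P \<Longrightarrow>
    \<exists>P'. P \<subseteq> P' \<and> generic P' \<and> \<not> emb Q P' \<and> blocks P' = {}"
proof (induction "card (blocks P)" arbitrary: P rule: less_induct)
  case less
  show ?case
  proof (cases "blocks P = {}")
    case False
    then obtain z where z: "generic (insert z P)" "\<not> emb Q (insert z P)"
      "\<not> decomposable (insert z P)" "card (blocks (insert z P)) < card (blocks P)"
      using improvable_if_blocks[OF less.prems(1) assms less.prems(2,3)] unfolding improvable_def by blast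
    show ?thesis using less.hyps[OF z(4,1-3)] by blast
  qed (use less.prems in blast)
qed

section \<open>Framing a point set to make it indecomposable\<close>

lemma generic_insert:
  "generic P \<Longrightarrow> fst z \<notin> fst ` P \<Longrightarrow> snd z \<notin> snd ` P \<Longrightarrow> generic (insert z P)"
  unfolding generic_def by auto

text \<open>The frame and \<open>P\<close> form 42513 with \<open>P\<close> inflating the 2. A frame
  point has too few points above and to its right to play \<open>a\<close>. With \<open>a\<close>
  inside \<open>P\<close>, two frame points are out of reach; the other two, highest and rightmost,
  could only play \<open>b\<close> and \<open>d\<close>, but if one of them is used,
  \<open>g\<close> and the other end cannot both be placed.\<close>

lemma framed_point_set:
  fixes c :: real
  assumes P: "generic P" "P \<noteq> {}" and Q: "bondless_wedge Q a b d" and av: "\<not> emb Q P"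
    and box: "\<And>p. p \<in> P \<Longrightarrow> 0 < fst p \<and> fst p < c \<and> 0 < snd p \<and> snd p < c"
  defines "F \<equiv> P \<union> {(0, c + 1), (c, c + 2), (c + 1, 0), (c + 2, c)}"
  shows "generic F" "\<not> emb Q F" "\<not> decomposable F"
proof -
  obtain p0 where p0: "p0 \<in> P" using P by blast
  have c: "0 < c" using box[OF p0] by auto
  show gF: "generic F"
  proof -
    have out: "x \<notin> fst ` P" "x \<notin> snd ` P" if "x \<le> 0 \<or> c \<le> x" for x
    proof -
      have "x \<noteq> fst p" "x \<noteq> snd p" if "p \<in> P" for p
        using box[OF that] \<open>x \<le> 0 \<or> c \<le> x\<close> by auto
      thus "x \<notin> fst ` P" "x \<notin> snd ` P" by blast+
    qed
    have "generic (insert (0, c + 1) (insert (c, c + 2) (insert (c + 1, 0) (insert (c + 2, c) P))))"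
      using c by (intro generic_insert P(1)) (simp_all add: out)
    thus ?thesis unfolding F_def by (simp add: insert_commute)
  qed
  show "\<not> decomposable F"
  proof
    assume "decomposable F"
    then obtain A B where AB: "A \<noteq> {}" "B \<noteq> {}" "A \<union> B = F" "\<forall>a\<in>A. \<forall>b\<in>B. fst a < fst b"
      "(\<forall>a\<in>A. \<forall>b\<in>B. snd a < snd b) \<or> (\<forall>a\<in>A. \<forall>b\<in>B. snd b < snd a)"
      unfolding decomposable_def by blast
    have nn: "0 \<le> fst p \<and> fst p \<le> c + 2" if "p \<in> F" for p
      using that box[of p] c unfolding F_def by auto
    have inF: "p0 \<in> A \<union> B" "(0, c + 1) \<in> A \<union> B" "(c, c + 2) \<in> A \<union> B" "(c + 2, c) \<in> A \<union> B"
      using p0 AB(3) unfolding F_def by auto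
    obtain u v where uv: "u \<in> A" "v \<in> B" using AB(1,2) by blast
    have uvF: "u \<in> F" "v \<in> F" using uv AB(3) by auto
    have first: "(0, c + 1) \<in> A"
    proof (rule ccontr)
      assume "\<not> ?thesis"
      hence "(0, c + 1) \<in> B" using inF(2) by blast
      thus False using bspec[OF bspec[OF AB(4) uv(1)], of "(0, c + 1)"] nn[OF uvF(1)] by simp
    qed
    have last: "(c + 2, c) \<in> B"
    proof (rule ccontr)
      assume "\<not> ?thesis"
      hence "(c + 2, c) \<in> A" using inF(4) by blast
      thus False using bspec[OF bspec[OF AB(4), of "(c + 2, c)"] uv(2)] nn[OF uvF(2)] by simp
    qed
    \<comment> \<open>The leftmost frame point is higher than the rightmost one, so only a skew
      decomposition is possible. It forces the highest point into \<open>A\<close>, and with it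
      \<open>p0\<close> to its left, although \<open>p0\<close> is below the rightmost point in
      \<open>B\<close>.\<close>
    have above: "snd q < snd p" if "p \<in> A" "q \<in> B" for p q
    proof -
      have "\<not> (\<forall>a\<in>A. \<forall>b\<in>B. snd a < snd b)"
      proof
        assume "\<forall>a\<in>A. \<forall>b\<in>B. snd a < snd b"
        from bspec[OF bspec[OF this first] last] show False by simp
      qed
      thus ?thesis using AB(5) that by blast
    qed
    have top: "(c, c + 2) \<in> A"
    proof (rule ccontr)
      assume "\<not> ?thesis"
      hence "(c, c + 2) \<in> B" using inF(3) by blast
      from above[OF first this] show False by simp
    qed
    have "p0 \<in> A"
    proof (rule ccontr)
      assume "\<not> ?thesis"
      hence "p0 \<in> B" using inF(1) by blast
      from bspec[OF bspec[OF AB(4) top] this] show False using box[OF p0] by simp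
    qed
    from above[OF this last] show False using box[OF p0] by simp
  qed
  show "\<not> emb Q F"
  proof
    assume "emb Q F"
    then obtain f where f: "f ` Q \<subseteq> F" "order_preserving f Q" unfolding emb_def by blast
    have gQ: "generic Q" and Qel: "a \<in> Q" "b \<in> Q" "d \<in> Q" "a \<noteq> b" "a \<noteq> d"
      using Q unfolding bondless_wedge_def by blast+
    have aless: "fst a < fst p \<and> snd a < snd p" if "p \<in> Q" "p \<noteq> a" for p
      using Q that unfolding bondless_wedge_def by blast
    have bless: "fst b < fst p \<and> snd p < snd b" if "p \<in> Q" "p \<noteq> a" "p \<noteq> b" for p
      using Q that unfolding bondless_wedge_def by blast
    have dless: "fst p < fst d \<and> snd d < snd p" if "p \<in> Q" "p \<noteq> a" "p \<noteq> d" for p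
      using Q that unfolding bondless_wedge_def by blast
    obtain g where g: "g \<in> Q" "g \<noteq> a" "g \<noteq> b" "g \<noteq> d" using Q unfolding bondless_wedge_def by blast
    note iff = order_preserving_iff[OF gQ f(2)]
    have Fel: "f p \<in> P \<or> f p = (0, c + 1) \<or> f p = (c, c + 2) \<or> f p = (c + 1, 0) \<or> f p = (c + 2, c)"
      if "p \<in> Q" for p using f(1) that unfolding F_def by blast
    have bg: "fst (f b) < fst (f g)" "snd (f g) < snd (f b)"
      using bless[OF g(1-3)] iff[OF Qel(2) g(1)] iff[OF g(1) Qel(2)] by auto
    have gd: "fst (f g) < fst (f d)" "snd (f d) < snd (f g)"
      using dless[OF g(1,2,4)] iff[OF Qel(3) g(1)] iff[OF g(1) Qel(3)] by auto
    have ad: "fst (f a) < fst (f d)" "snd (f a) < snd (f d)"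
      using aless[of d] Qel iff[OF Qel(1,3)] by auto
    have ab: "fst (f a) < fst (f b)" "snd (f a) < snd (f b)"
      using aless[of b] Qel iff[OF Qel(1,2)] by auto
    have faP: "f a \<in> P"
    proof (rule ccontr)
      assume n: "f a \<notin> P"
      have up: "f p = (c, c + 2) \<or> f p = (c + 2, c)" if "fst (f a) < fst (f p)" "snd (f a) < snd (f p)" "p \<in> Q" for p
        using Fel[OF Qel(1)] Fel[OF that(3)] box[of "f p"] that(1,2) n c by auto
      have "fst (f a) < fst (f g)" "snd (f a) < snd (f g)" using ab bg ad gd by linarith+
      hence "f g = (c, c + 2) \<or> f g = (c + 2, c)" using up g(1) by blast
      moreover have "f b = (c, c + 2) \<or> f b = (c + 2, c)" using up[OF ab Qel(2)] .
      moreover have "f d = (c, c + 2) \<or> f d = (c + 2, c)" using up[OF ad Qel(3)] .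
      ultimately show False using bg gd by auto
    qed
    have not0: "f p \<noteq> (0, c + 1) \<and> f p \<noteq> (c + 1, 0)" if "p \<in> Q" "p \<noteq> a" for p
      using aless[OF that] iff[OF Qel(1) that(1)] box[OF faP] by auto
    have three: "f p \<in> P \<or> f p = (c, c + 2) \<or> f p = (c + 2, c)" if "p \<in> Q" "p \<noteq> a" for p
      using Fel[OF that(1)] not0[OF that] by blast
    have le: "fst (f p) \<le> c + 2 \<and> snd (f p) \<le> c + 2" if "p \<in> Q" "p \<noteq> a" for p
      using three[OF that] box[of "f p"] c by auto
    have da: "d \<noteq> a" "b \<noteq> a" using Qel by auto
    have not1: "f p \<noteq> (c, c + 2)" if p: "p \<in> Q" "p \<noteq> a" for p
    proof
      assume fp: "f p = (c, c + 2)"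
      have "p = b"
        using bless[OF p] iff(2)[OF p(1) Qel(2)] fp le[OF Qel(2) da(2)] by auto
      hence "f g = (c + 2, c)" using three[OF g(1,2)] box[of "f g"] bg fp \<open>p = b\<close> by auto
      thus False using gd le[OF Qel(3) da(1)] by simp
    qed
    have not2: "f p \<noteq> (c + 2, c)" if p: "p \<in> Q" "p \<noteq> a" for p
    proof
      assume fp: "f p = (c + 2, c)"
      have "p = d"
        using dless[OF p] iff(1)[OF p(1) Qel(3)] fp le[OF Qel(3) da(1)] by auto
      hence "f g = (c, c + 2)" using three[OF g(1,2)] box[of "f g"] gd fp \<open>p = d\<close> by auto
      thus False using not1[OF g(1,2)] by simp
    qed
    have "f ` Q \<subseteq> P" using three not1 not2 faP by blast
    thus False using f(2) av unfolding emb_def by blast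
  qed
qed

subsection \<open>Permutations as point sets\<close>

text \<open>List positions start at 0 but are drawn from 1 on, so that coordinates of permutations
  are positive and 0 stays free for the frame.\<close>

definition point :: "nat list \<Rightarrow> nat \<Rightarrow> real \<times> real" where
  "point \<sigma> i = (real (Suc i), real (\<sigma> ! i))"

definition points :: "nat list \<Rightarrow> (real \<times> real) set" where
  "points \<sigma> = point \<sigma> ` {..<length \<sigma>}"

lemma point_sel [simp]: "fst (point \<sigma> i) = real (Suc i)" "snd (point \<sigma> i) = real (\<sigma> ! i)"
  unfolding point_def by simp_all

lemma is_permD:
  assumes "is_perm \<sigma>"
  shows "\<sigma> \<noteq> []" "distinct \<sigma>" "set \<sigma> = {1..length \<sigma>}"
  using assms unfolding is_perm_def permutations_of_set_def by auto

lemma generic_points: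
  assumes "distinct \<sigma>"
  shows "generic (points \<sigma>)"
proof -
  have "inj_on fst (points \<sigma>)" by (auto simp: inj_on_def points_def)
  moreover have "inj_on snd (points \<sigma>)"
    using assms by (auto simp: inj_on_def points_def nth_eq_iff_index_eq)
  ultimately show ?thesis unfolding generic_def by (simp add: points_def)
qed

lemma emb_imageI:
  assumes u: "inj_on u S" and v: "v ` S \<subseteq> B"
    and "\<And>i j. i \<in> S \<Longrightarrow> j \<in> S \<Longrightarrow> fst (u i) < fst (u j) \<Longrightarrow> fst (v i) < fst (v j)"
    and "\<And>i j. i \<in> S \<Longrightarrow> j \<in> S \<Longrightarrow> snd (u i) < snd (u j) \<Longrightarrow> snd (v i) < snd (v j)"
  shows "emb (u ` S) B"
  unfolding emb_def
proof (intro exI conjI)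
  let ?f = "v \<circ> inv_into S u"
  show "?f ` u ` S \<subseteq> B" using u v by auto
  show "order_preserving ?f (u ` S)"
    using assms unfolding order_preserving_def by auto
qed

lemma subseqD:
  assumes "subseq s \<beta>"
  shows "\<exists>g. (\<forall>i<length s. g i < length \<beta> \<and> s ! i = \<beta> ! g i) \<and> (\<forall>i<length s. \<forall>j<length s. i < j \<longrightarrow> g i < g j)"
  using assms
proof (induction rule: list_emb.induct)
  case (list_emb_Cons xs ys y)
  then obtain g where "\<forall>i<length xs. g i < length ys \<and> xs ! i = ys ! g i"
    "\<forall>i<length xs. \<forall>j<length xs. i < j \<longrightarrow> g i < g j" by blast
  thus ?case by (intro exI[of _ "Suc \<circ> g"]) auto
next
  case (list_emb_Cons2 x y xs ys)
  then obtain g where "\<forall>i<length xs. g i < length ys \<and> xs ! i = ys ! g i"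
    "\<forall>i<length xs. \<forall>j<length xs. i < j \<longrightarrow> g i < g j" by blast
  thus ?case using list_emb_Cons2.hyps
    by (intro exI[of _ "case_nat 0 (Suc \<circ> g)"]) (auto split: nat.split simp: nth_Cons)
qed simp

text \<open>Induction on \<beta>: if the first chosen position is 0, the heads are matched;
  otherwise the head of \<beta> is dropped. The positions that are shifted down are positive, so
  truncated subtraction does no harm.\<close>

lemma subseqI:
  assumes "\<And>i. i < length s \<Longrightarrow> g i < length \<beta> \<and> s ! i = \<beta> ! g i"
    and "\<And>i j. i < j \<Longrightarrow> j < length s \<Longrightarrow> g i < g j"
  shows "subseq s \<beta>"
  using assms
proof (induction \<beta> arbitrary: s g)
  case Nil
  thus ?case by (cases s) auto
next
  case (Cons y ys)
  show ?case
  proof (cases s)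
    case s: (Cons x xs)
    show ?thesis
    proof (cases "g 0 = 0")
      case True
      have pos: "0 < g (Suc i)" if "i < length xs" for i
        using Cons.prems(2)[of 0 "Suc i"] that s by simp
      have "subseq xs ys"
      proof (rule Cons.IH[of _ "\<lambda>i. g (Suc i) - 1"])
        fix i assume i: "i < length xs"
        show "g (Suc i) - 1 < length ys \<and> xs ! i = ys ! (g (Suc i) - 1)"
          using Cons.prems(1)[of "Suc i"] pos[OF i] i s by (auto simp: nth_Cons')
      next
        fix i j assume "i < j" "j < length xs"
        thus "g (Suc i) - 1 < g (Suc j) - 1"
          using Cons.prems(2)[of "Suc i" "Suc j"] pos[of i] s by simp
      qed
      moreover have "x = y" using Cons.prems(1)[of 0] True s by simp
      ultimately show ?thesis using s by simp
    next
      case False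
      have pos: "0 < g i" if "i < length s" for i
        using Cons.prems(2)[of 0 i] that False by (cases i) auto
      have "subseq s ys"
      proof (rule Cons.IH[of _ "\<lambda>i. g i - 1"])
        fix i assume i: "i < length s"
        show "g i - 1 < length ys \<and> s ! i = ys ! (g i - 1)"
          using Cons.prems(1)[OF i] pos[OF i] by (auto simp: nth_Cons')
      next
        fix i j assume "i < j" "j < length s"
        thus "g i - 1 < g j - 1" using Cons.prems(2)[of i j] pos[of i] by simp
      qed
      thus ?thesis by (rule list_emb_Cons)
    qed
  qed simp
qed

text \<open>Increasing position maps account for the first coordinate, order isomorphism for the
  second. Distinctness of \<alpha> makes its point set generic, so an embedding also reflects both
  orders.\<close>

lemma contained_iff_emb:
  assumes "distinct \<alpha>"
  shows "contained \<alpha> \<beta> \<longleftrightarrow> emb (points \<alpha>) (points \<beta>)"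
proof
  assume "contained \<alpha> \<beta>"
  then obtain s where s: "subseq s \<beta>" "order_isomorphic \<alpha> s" unfolding contained_def by blast
  then obtain g where g: "\<forall>i<length s. g i < length \<beta> \<and> s ! i = \<beta> ! g i"
    "\<forall>i<length s. \<forall>j<length s. i < j \<longrightarrow> g i < g j" using subseqD by blast
  have len: "length s = length \<alpha>"
    and iso: "\<And>i j. i < length \<alpha> \<Longrightarrow> j < length \<alpha> \<Longrightarrow> \<alpha> ! i < \<alpha> ! j \<longleftrightarrow> s ! i < s ! j"
    using s(2) unfolding order_isomorphic_def by auto
  show "emb (points \<alpha>) (points \<beta>)"
    unfolding points_def[of \<alpha>]
  proof (rule emb_imageI[where v = "\<lambda>i. point \<beta> (g i)"])
    show "inj_on (point \<alpha>) {..<length \<alpha>}" by (auto simp: inj_on_def point_def)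
    show "(\<lambda>i. point \<beta> (g i)) ` {..<length \<alpha>} \<subseteq> points \<beta>" using g(1) len unfolding points_def by auto
  qed (use g len iso in auto)
next
  assume "emb (points \<alpha>) (points \<beta>)"
  then obtain f where f: "f ` points \<alpha> \<subseteq> points \<beta>" "order_preserving f (points \<alpha>)"
    unfolding emb_def by blast
  have "\<forall>i<length \<alpha>. \<exists>k<length \<beta>. f (point \<alpha> i) = point \<beta> k"
    using f(1) unfolding points_def by auto
  then obtain g where g: "\<And>i. i < length \<alpha> \<Longrightarrow> g i < length \<beta> \<and> f (point \<alpha> i) = point \<beta> (g i)"
    by metis
  have iff: "g i < g j \<longleftrightarrow> i < j" "\<beta> ! g i < \<beta> ! g j \<longleftrightarrow> \<alpha> ! i < \<alpha> ! j"
    if "i < length \<alpha>" "j < length \<alpha>" for i j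
    using order_preserving_iff[OF generic_points[OF assms] f(2), of "point \<alpha> i" "point \<alpha> j"] g that
    unfolding points_def by auto
  define s where "s = map (\<lambda>i. \<beta> ! g i) [0..<length \<alpha>]"
  have "subseq s \<beta>" by (rule subseqI[of _ g]) (use g iff in \<open>auto simp: s_def\<close>)
  moreover have "order_isomorphic \<alpha> s" unfolding order_isomorphic_def s_def using iff by simp
  ultimately show "contained \<alpha> \<beta>" unfolding contained_def by blast
qed

text \<open>Coordinates are replaced by ranks. Of the two embeddings, one transfers containment of a
  given permutation, the other avoidance.\<close>

lemma ex_standardization:
  assumes P: "generic P" "P \<noteq> {}"
  obtains \<tau> where "is_perm \<tau>" "emb P (points \<tau>)" "emb (points \<tau>) P" "blocks P = {} \<Longrightarrow> simple_perm \<tau>"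
proof -
  have fin: "finite P" using P unfolding generic_def by blast
  define N where "N = card P"
  \<comment> \<open>Strict counting gives ranks from 0 to \<open>N - 1\<close>, which are list
    positions; weak counting gives ranks from 1 to \<open>N\<close>, which are values.\<close>
  define rx where "rx p = card {q \<in> P. fst q < fst p}" for p :: "real \<times> real"
  define ry where "ry p = card {q \<in> P. snd q \<le> snd p}" for p :: "real \<times> real"
  have rx_less: "rx p < rx q" if "p \<in> P" "fst p < fst q" for p q
    unfolding rx_def using that fin by (intro psubset_card_mono) auto
  have ry_less: "ry p < ry q" if "q \<in> P" "snd p < snd q" for p q
  proof -
    have "{s \<in> P. snd s \<le> snd p} \<subseteq> {s \<in> P. snd s \<le> snd q}" using that by auto
    moreover have "q \<in> {s \<in> P. snd s \<le> snd q}" "q \<notin> {s \<in> P. snd s \<le> snd p}" using that by auto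
    ultimately have "{s \<in> P. snd s \<le> snd p} \<subset> {s \<in> P. snd s \<le> snd q}" by blast
    thus ?thesis unfolding ry_def using fin by (intro psubset_card_mono) simp_all
  qed
  have rx_iff: "rx p < rx q \<longleftrightarrow> fst p < fst q" if "p \<in> P" "q \<in> P" for p q
    using rx_less[of p q] rx_less[of q p] generic_eq[OF P(1), of p q] that
    by (cases "fst p" "fst q" rule: linorder_cases) auto
  have ry_iff: "ry p < ry q \<longleftrightarrow> snd p < snd q" if "p \<in> P" "q \<in> P" for p q
    using ry_less[of p q] ry_less[of q p] generic_eq[OF P(1), of p q] that
    by (cases "snd p" "snd q" rule: linorder_cases) auto
  have inj_rx: "inj_on rx P"
  proof (rule inj_onI)
    fix p q assume h: "p \<in> P" "q \<in> P" "rx p = rx q"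
    hence "fst p = fst q" using rx_iff[OF h(1,2)] rx_iff[OF h(2,1)] by auto
    thus "p = q" using generic_eq[OF P(1) h(1,2)] by simp
  qed
  have inj_ry: "inj_on ry P"
  proof (rule inj_onI)
    fix p q assume h: "p \<in> P" "q \<in> P" "ry p = ry q"
    hence "snd p = snd q" using ry_iff[OF h(1,2)] ry_iff[OF h(2,1)] by auto
    thus "p = q" using generic_eq[OF P(1) h(1,2)] by simp
  qed
  have img_rx: "rx ` P = {..<N}"
  proof (rule card_subset_eq)
    show "rx ` P \<subseteq> {..<N}"
      unfolding rx_def N_def using fin by (auto intro!: psubset_card_mono)
    show "card (rx ` P) = card {..<N}" using card_image[OF inj_rx] by (simp add: N_def)
  qed simp
  have img_ry: "ry ` P = {1..N}"
  proof (rule card_subset_eq)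
    show "ry ` P \<subseteq> {1..N}"
    proof
      fix y assume "y \<in> ry ` P"
      then obtain p where p: "p \<in> P" "y = ry p" by blast
      have "p \<in> {q \<in> P. snd q \<le> snd p}" using p(1) by simp
      moreover have "finite {q \<in> P. snd q \<le> snd p}" using fin by simp
      ultimately have "card {q \<in> P. snd q \<le> snd p} \<noteq> 0" by (metis card_0_eq emptyE)
      moreover have "card {q \<in> P. snd q \<le> snd p} \<le> N" unfolding N_def using fin by (intro card_mono) auto
      ultimately show "y \<in> {1..N}" unfolding p(2) ry_def by simp
    qed
    show "card (ry ` P) = card {1..N}" using card_image[OF inj_ry] by (simp add: N_def)
  qed simp
  define h where "h = inv_into P rx"
  have h: "h i \<in> P" "rx (h i) = i" if "i < N" for i
    using that img_rx unfolding h_def by (auto intro: inv_into_into f_inv_into_f)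
  have hrx: "h (rx p) = p" if "p \<in> P" for p using that inj_rx unfolding h_def by simp
  define \<tau> where "\<tau> = map (ry \<circ> h) [0..<N]"
  have len: "length \<tau> = N" by (simp add: \<tau>_def)
  have nth: "\<tau> ! rx p = ry p" if "p \<in> P" for p
  proof -
    have "rx p < N" using img_rx that by blast
    thus ?thesis using hrx[OF that] by (simp add: \<tau>_def)
  qed
  have pts: "points \<tau> = (\<lambda>p. (real (Suc (rx p)), real (ry p))) ` P"
  proof -
    have "points \<tau> = point \<tau> ` rx ` P" unfolding points_def len img_rx by simp
    also have "\<dots> = (\<lambda>p. (real (Suc (rx p)), real (ry p))) ` P"
      unfolding image_image point_def by (rule image_cong) (simp_all add: nth)
    finally show ?thesis .
  qed
  have himg: "h ` {..<N} = P" unfolding img_rx[symmetric] image_image using hrx by simp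
  have perm: "is_perm \<tau>"
  proof -
    have "set \<tau> = ry ` h ` {..<N}" by (auto simp: \<tau>_def image_image)
    hence set: "set \<tau> = {1..N}" using himg img_ry by simp
    hence "card (set \<tau>) = length \<tau>" using len by simp
    hence "distinct \<tau>" by (rule card_distinct)
    moreover have "\<tau> \<noteq> []" using P fin by (simp add: \<tau>_def N_def)
    ultimately show ?thesis using set len unfolding is_perm_def permutations_of_set_def by simp
  qed
  have "emb (id ` P) (points \<tau>)"
    by (rule emb_imageI[where v = "\<lambda>p. (real (Suc (rx p)), real (ry p))"])
      (auto simp: pts rx_iff ry_iff)
  hence e1: "emb P (points \<tau>)" by simp
  have e2: "emb (points \<tau>) P" unfolding pts
    by (rule emb_imageI[where v = id]) (use inj_rx in \<open>auto simp: rx_iff ry_iff inj_on_def\<close>)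
  have "simple_perm \<tau>" if noblocks: "blocks P = {}"
    unfolding simple_perm_def
  proof (intro conjI allI impI)
    fix J assume "interval \<tau> J"
    then obtain a b c d where J: "J \<noteq> {}" "J \<subset> {..<N}" "J = {a..b}" "(!) \<tau> ` J = {c..d}"
      unfolding interval_def len by blast
    \<comment> \<open>Pulled back to \<open>P\<close>, consecutiveness of positions and of values
      becomes convexity in the two coordinates. So \<open>K\<close> is a proper block and, by
      assumption, has at most one point.\<close>
    define K where "K = {p \<in> P. rx p \<in> J}"
    have "block P K"
      unfolding block_def
    proof (intro conjI ballI impI)
      show "K \<subseteq> P" unfolding K_def by blast
      fix p u v assume p: "p \<in> P" and u: "u \<in> K" and v: "v \<in> K"
      have uv: "u \<in> P" "v \<in> P" "rx u \<in> J" "rx v \<in> J" using u v unfolding K_def by auto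
      show "p \<in> K" if "fst u < fst p \<and> fst p < fst v"
      proof -
        have "rx u < rx p" "rx p < rx v" using that rx_iff p uv by auto
        thus ?thesis using uv(3,4) p unfolding K_def J(3) by simp
      qed
      show "p \<in> K" if "snd u < snd p \<and> snd p < snd v"
      proof -
        have "ry u < ry p" "ry p < ry v" using that ry_iff p uv by auto
        moreover have "ry u \<in> {c..d}" "ry v \<in> {c..d}" using uv nth J(4) by (metis imageI)+
        ultimately have "ry p \<in> {c..d}" by simp
        then obtain j where j: "j \<in> J" "ry p = \<tau> ! j" using J(4) by (metis imageE)
        have jN: "j < N" using j(1) J(2) by blast
        have "ry p = ry (h j)" using j(2) nth[OF h(1)[OF jN]] h(2)[OF jN] by simp
        hence "p = h j" using inj_ry p h(1)[OF jN] by (meson inj_onD)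
        thus ?thesis using p j(1) h(2)[OF jN] unfolding K_def by simp
      qed
    qed
    moreover have "K \<noteq> P"
    proof
      assume "K = P"
      hence "rx p \<in> J" if "p \<in> P" for p using that unfolding K_def by blast
      hence "{..<N} \<subseteq> J" unfolding img_rx[symmetric] by (rule image_subsetI)
      thus False using J(2) by blast
    qed
    ultimately have single: "p = q" if "p \<in> K" "q \<in> K" for p q
      using noblocks that unfolding blocks_def by blast
    obtain j where j: "j \<in> J" using J(1) by blast
    have "J = {j}"
    proof -
      have "i = j" if "i \<in> J" for i
      proof -
        have N: "i < N" "j < N" using that j J(2) by auto
        have "h i = h j" using h N that j by (intro single) (auto simp: K_def)
        thus ?thesis using h(2) N by metis
      qed
      thus ?thesis using j by blast
    qed
    thus "card J = 1" by simp
  qed (rule perm)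
  thus ?thesis using that perm e1 e2 by blast
qed

lemma bondless_wedge_points:
  assumes perm: "is_perm \<pi>" and \<rho>: "\<pi> = one_oplus \<rho>" and n: "length \<pi> = n" "n \<ge> 4"
    and ends: "\<pi> ! 0 = 1" "\<pi> ! 1 = n" "\<pi> ! (n - 1) = 2" and bond: "\<not> has_increasing_bond \<rho>"
  shows "bondless_wedge (points \<pi>) (point \<pi> 0) (point \<pi> 1) (point \<pi> (n - 1))"
proof -
  note pD = is_permD[OF perm]
  have inj: "\<pi> ! i = \<pi> ! j \<longleftrightarrow> i = j" if "i < n" "j < n" for i j
    using pD(2) that n by (simp add: nth_eq_iff_index_eq)
  have rng: "1 \<le> \<pi> ! i" "\<pi> ! i \<le> n" if "i < n" for i
    using pD(3) that n nth_mem[of i \<pi>] by auto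
  have pinj: "point \<pi> i = point \<pi> j \<longleftrightarrow> i = j" for i j by (auto simp: point_def)
  have mem: "point \<pi> i \<in> points \<pi>" if "i < n" for i using that n unfolding points_def by blast
  have ex: "\<exists>i<n. p = point \<pi> i" if "p \<in> points \<pi>" for p using that n unfolding points_def by auto
  show ?thesis
    unfolding bondless_wedge_def
  proof (intro conjI ballI impI)
    show "generic (points \<pi>)" by (rule generic_points[OF pD(2)])
    show "point \<pi> 0 \<in> points \<pi>" "point \<pi> 1 \<in> points \<pi>" "point \<pi> (n - 1) \<in> points \<pi>"
      using n by (auto intro: mem)
    show "point \<pi> 0 \<noteq> point \<pi> 1" "point \<pi> 0 \<noteq> point \<pi> (n - 1)" using n by (auto simp: pinj)
    \<comment> \<open>Position 2 differs from \<open>n - 1\<close> because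
      \<open>n \<ge> 4\<close>.\<close>
    show "\<exists>g\<in>points \<pi>. g \<notin> {point \<pi> 0, point \<pi> 1, point \<pi> (n - 1)}"
      using n by (intro bexI[of _ "point \<pi> 2"] mem) (auto simp: pinj)
  next
    fix p assume p: "p \<in> points \<pi> - {point \<pi> 0}"
    then obtain i where i': "i < n" "p = point \<pi> i" using ex[of p] by auto
    have ne: "i \<noteq> 0" using p i'(2) by (metis DiffD2 insertCI)+
    note i = i' ne
    show "fst (point \<pi> 0) < fst p" using i by simp
    have "\<pi> ! i \<noteq> 1" using inj[of i 0] i n ends by simp
    thus "snd (point \<pi> 0) < snd p" using i rng(1)[of i] ends by simp
  next
    fix p assume p: "p \<in> points \<pi> - {point \<pi> 0, point \<pi> 1}"
    then obtain i where i': "i < n" "p = point \<pi> i" using ex[of p] by auto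
    have ne: "i \<noteq> 0" "i \<noteq> 1" using p i'(2) by (metis DiffD2 insertCI)+
    note i = i' ne
    show "fst (point \<pi> 1) < fst p" using i by simp
    have "\<pi> ! i \<noteq> n" using inj[of i 1] i n ends by simp
    thus "snd p < snd (point \<pi> 1)" using i rng(2)[of i] ends by simp
  next
    fix p assume p: "p \<in> points \<pi> - {point \<pi> 0, point \<pi> (n - 1)}"
    then obtain i where i': "i < n" "p = point \<pi> i" using ex[of p] by auto
    have ne: "i \<noteq> 0" "i \<noteq> n - 1" using p i'(2) by (metis DiffD2 insertCI)+
    note i = i' ne
    show "fst p < fst (point \<pi> (n - 1))" using i by simp
    have "\<pi> ! i \<noteq> 1" "\<pi> ! i \<noteq> 2" using inj[of i 0] inj[of i "n - 1"] i n ends by auto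
    thus "snd (point \<pi> (n - 1)) < snd p" using i rng(1)[of i] ends by simp
  next
    fix p q assume p: "p \<in> points \<pi> - {point \<pi> 0}" and q: "q \<in> points \<pi>"
      and less: "fst p < fst q \<and> snd p < snd q"
    obtain i where i': "i < n" "p = point \<pi> i" using ex[of p] p by auto
    have ne: "i \<noteq> 0" using p i'(2) by (metis DiffD2 insertCI)+
    note i = i' ne
    obtain j where j: "j < n" "q = point \<pi> j" using ex[of q] q by auto
    have ij: "i < j" "\<pi> ! i < \<pi> ! j" using less i j by auto
    \<comment> \<open>Either a position or a value lies strictly between, and some entry attains it
      since all values from 1 to \<open>n\<close> occur, or the two entries form an increasing bond
      of \<pi>.\<close>
    consider "Suc i < j" | "Suc (\<pi> ! i) < \<pi> ! j" | "j = Suc i" "\<pi> ! j = Suc (\<pi> ! i)"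
      using ij by linarith
    thus "\<exists>r\<in>points \<pi>. fst p < fst r \<and> fst r < fst q \<or> snd p < snd r \<and> snd r < snd q"
    proof cases
      case 1
      thus ?thesis using i j by (intro bexI[of _ "point \<pi> (Suc i)"] mem) auto
    next
      case 2
      hence "Suc (\<pi> ! i) \<in> set \<pi>" using pD(3) n rng(2)[OF j(1)] by simp
      then obtain k where k: "k < n" "\<pi> ! k = Suc (\<pi> ! i)" using n by (auto simp: in_set_conv_nth)
      thus ?thesis using i j 2 by (intro bexI[of _ "point \<pi> k"] mem) auto
    next
      case 3
      \<comment> \<open>Both entries come after the initial 1, so positions and values shift down by
        one to give a bond of \<rho>.\<close>
      obtain i' where i': "i = Suc i'" using i(3) by (cases i) auto
      have "bond_at \<rho> i' \<and> \<rho> ! i' < \<rho> ! Suc i'"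
        using 3 i i' j n(1) \<rho> unfolding bond_at_def one_oplus_def by auto
      thus ?thesis using bond unfolding has_increasing_bond_def by blast
    qed
  qed
qed

section \<open>From simple extensions to non-deflatability\<close>

lemma ex_simple_extension:
  assumes Q: "bondless_wedge (points \<pi>) a b d" and \<pi>: "distinct \<pi>" and \<alpha>: "\<alpha> \<in> Av \<pi>"
  shows "\<exists>\<tau>\<in>Av \<pi>. simple_perm \<tau> \<and> contained \<alpha> \<tau>"
proof -
  have perm: "is_perm \<alpha>" and av: "\<not> emb (points \<pi>) (points \<alpha>)"
    using \<alpha> contained_iff_emb[OF \<pi>] unfolding Av_def by auto
  note pD = is_permD[OF perm]
  \<comment> \<open>The least integer above all positions and values, so the square from 0 to
    \<open>c\<close> strictly encloses \<alpha>.\<close>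
  define c where "c = real (Suc (length \<alpha>))"
  define F where "F = points \<alpha> \<union> {(0, c + 1), (c, c + 2), (c + 1, 0), (c + 2, c)}"
  have ne: "points \<alpha> \<noteq> {}" using pD(1) unfolding points_def by auto
  have box: "0 < fst p \<and> fst p < c \<and> 0 < snd p \<and> snd p < c" if p: "p \<in> points \<alpha>" for p
  proof -
    obtain i where i: "i < length \<alpha>" "p = point \<alpha> i" using p unfolding points_def by auto
    have "\<alpha> ! i \<in> {1..length \<alpha>}" using pD(3) nth_mem[OF i(1)] by simp
    thus ?thesis using i by (simp add: c_def)
  qed
  note framed = framed_point_set[OF generic_points[OF pD(2)] ne Q av box, folded F_def]
  obtain P where P: "F \<subseteq> P" "generic P" "\<not> emb (points \<pi>) P" "blocks P = {}"
    using ex_blockless_extension[OF Q framed] by blast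
  have "P \<noteq> {}" using P(1) unfolding F_def by blast
  then obtain \<tau> where \<tau>: "is_perm \<tau>" "emb P (points \<tau>)" "emb (points \<tau>) P" "simple_perm \<tau>"
    using ex_standardization[OF P(2)] P(4) by metis
  have "emb (points \<alpha>) P"
    unfolding emb_def using P(1) by (intro exI[of _ id]) (auto simp: F_def order_preserving_def)
  hence "contained \<alpha> \<tau>" using emb_trans[OF _ \<tau>(2)] contained_iff_emb[OF pD(2)] by blast
  moreover have "\<not> contained \<pi> \<tau>"
    using emb_trans[OF _ \<tau>(3)] P(3) contained_iff_emb[OF \<pi>] by blast
  ultimately show ?thesis using \<tau>(1,4) unfolding Av_def by blast
qed

text \<open>A proper subclass \<open>D\<close> misses some \<alpha>. The simple \<tau> containing
  \<alpha> lies in the closure of \<open>D\<close>, whose simple members are those of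
  \<open>D\<close>; so \<tau>, and with it \<alpha>, would be in \<open>D\<close>.\<close>

lemma not_deflatableI:
  assumes C: "\<And>\<sigma>. \<sigma> \<in> C \<Longrightarrow> is_perm \<sigma>"
    and ext: "\<And>\<alpha>. \<alpha> \<in> C \<Longrightarrow> \<exists>\<tau>\<in>C. simple_perm \<tau> \<and> contained \<alpha> \<tau>"
  shows "\<not> deflatable C"
proof
  assume "deflatable C"
  then obtain D where D: "perm_class D" "D \<subset> C" "C \<subseteq> subst_closure D" unfolding deflatable_def by blast
  obtain \<alpha> where \<alpha>: "\<alpha> \<in> C" "\<alpha> \<notin> D" using D(2) by blast
  obtain \<tau> where \<tau>: "\<tau> \<in> C" "simple_perm \<tau>" "contained \<alpha> \<tau>" using ext[OF \<alpha>(1)] by blast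
  have "\<tau> \<in> simples (subst_closure D)" using \<tau> D(3) unfolding simples_def by blast
  hence "\<tau> \<in> D" using subst_closure_greatest(2)[OF D(1)] unfolding simples_def by blast
  hence "\<alpha> \<in> D" using D(1) \<tau>(3) C[OF \<alpha>(1)] unfolding perm_class_def by blast
  thus False using \<alpha>(2) by blast
qed

theorem theorem3p5:
  fixes \<pi> \<rho> :: "nat list" and n :: nat
  assumes "is_perm \<rho>" and "is_perm \<pi>" and "\<pi> = one_oplus \<rho>"
    and "length \<pi> = n" and "n \<ge> 4"
    and "\<pi> ! 0 = 1" and "\<pi> ! 1 = n" and "\<pi> ! (n - 1) = 2"
    and "\<not> has_increasing_bond \<rho>"
  shows "\<not> deflatable (Av \<pi>)"
proof (rule not_deflatableI)
  show "is_perm \<sigma>" if "\<sigma> \<in> Av \<pi>" for \<sigma> using that unfolding Av_def by blast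
  show "\<exists>\<tau>\<in>Av \<pi>. simple_perm \<tau> \<and> contained \<alpha> \<tau>" if "\<alpha> \<in> Av \<pi>" for \<alpha>
    by (rule ex_simple_extension[OF bondless_wedge_points[OF assms(2-9)] is_permD(2)[OF assms(2)] that])
qed

end
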